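(* Let $n\in\mathbb{N}$ and $\varepsilon>0$. Then there exist non-empty open sets $W_1,W_2,W_3\subset(1-\varepsilon,1+\varepsilon)^n$ (sets of mass vectors $(m_1,\dots,m_n)$) and non-empty open sets $U_1,U_2,U_3\subset\mathbb{R}^n\times\mathbb{R}^n$ (sets of initial data $(q,v)$ with $q_1<q_2<\dots<q_n$), such that, setting $V_i:=W_i\times U_i$, for every $(m,q,v)\in V_i$ the system of $n$ point particles with masses $m$ and initial positions $q$ and velocities $v$ at time $0$ undergoes only binary collisions and the number of collisions occurring at positive times equals (1) $n-1=\binom{n-1}{1}$ if $(m,q,v)\in V_1$; (2) $\binom{n}{2}$ if $(m,q,v)\in V_2$; (3) $\binom{n+1}{3}$ if $(m,q,v)\in V_3$.
   Context: Dynamics: $n$ point particles of masses $m_1,\dots,m_n>0$ move on $\mathbb{R}$ with positions $q_1(t)\le\dots\le q_n(t)$, order preserved. Between collisions each particle moves with constant velocity. A collision is an instant where $q_i=q_{i+1}$; in a binary collision of particles $i$ and $i+1$ with incoming velocities $v_i,v_{i+1}$, the outgoing velocities are $v_i'=\frac{(m_i-m_{i+1})v_i+2m_{i+1}v_{i+1}}{m_i+m_{i+1}}$, $v_{i+1}'=\frac{(m_{i+1}-m_i)v_{i+1}+2m_i v_i}{m_i+m_{i+1}}$ (elastic collision: conservation of momentum and kinetic energy); all other velocities are unchanged. The sets $W_i$ lie in an arbitrarily small neighbourhood of the diagonal $m_1=\dots=m_n=1$ of mass space. *)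

theory Defs
  imports "HOL-Analysis.Analysis"
begin

text \<open>Particles are indexed 0..n-1 (paper: 1..n). Vectors in R^n are represented as
  functions nat => real vanishing at indices >= n; R^n carries the subspace topology of the
  product topology on nat => real, which is the Euclidean topology.\<close>

definition Rn :: "nat \<Rightarrow> (nat \<Rightarrow> real) set" where
  "Rn n = {x. \<forall>i\<ge>n. x i = 0}"

definition mass_box :: "nat \<Rightarrow> real \<Rightarrow> (nat \<Rightarrow> real) set" where
  "mass_box n \<epsilon> = {m \<in> Rn n. \<forall>i<n. 1 - \<epsilon> < m i \<and> m i < 1 + \<epsilon> \<and> 0 < m i}"

definition ordered_data :: "nat \<Rightarrow> ((nat \<Rightarrow> real) \<times> (nat \<Rightarrow> real)) set" where
  "ordered_data n = {(q, v). q \<in> Rn n \<and> v \<in> Rn n \<and> (\<forall>i. Suc i < n \<longrightarrow> q i < q (Suc i))}"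

definition meets :: "(nat \<Rightarrow> real) \<Rightarrow> (nat \<Rightarrow> real) \<Rightarrow> real \<Rightarrow> nat \<Rightarrow> bool" where
  "meets q v t i \<longleftrightarrow> q i + t * v i = q (Suc i) + t * v (Suc i)"

definition coll_pairs :: "nat \<Rightarrow> (nat \<Rightarrow> real) \<Rightarrow> (nat \<Rightarrow> real) \<Rightarrow> real \<Rightarrow> nat set" where
  "coll_pairs n q v t = {i. Suc i < n \<and> meets q v t i}"

definition first_coll_time :: "nat \<Rightarrow> (nat \<Rightarrow> real) \<Rightarrow> (nat \<Rightarrow> real) \<Rightarrow> real \<Rightarrow> bool" where
  "first_coll_time n q v t \<longleftrightarrow> 0 < t \<and> coll_pairs n q v t \<noteq> {} \<and>
     (\<forall>s. 0 < s \<and> s < t \<longrightarrow> coll_pairs n q v s = {})"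

definition binary_pairs :: "nat set \<Rightarrow> bool" where
  "binary_pairs C \<longleftrightarrow> (\<forall>i\<in>C. Suc i \<notin> C)"

text \<open>Elastic collision: outgoing velocities of the left and right particle.\<close>
definition out_left :: "real \<Rightarrow> real \<Rightarrow> real \<Rightarrow> real \<Rightarrow> real" where
  "out_left mi mj vi vj = ((mi - mj) * vi + 2 * mj * vj) / (mi + mj)"

definition out_right :: "real \<Rightarrow> real \<Rightarrow> real \<Rightarrow> real \<Rightarrow> real" where
  "out_right mi mj vi vj = ((mj - mi) * vj + 2 * mi * vi) / (mi + mj)"

definition post_vel :: "(nat \<Rightarrow> real) \<Rightarrow> nat set \<Rightarrow> (nat \<Rightarrow> real) \<Rightarrow> (nat \<Rightarrow> real)" where
  "post_vel m C v = (\<lambda>j.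
     if j \<in> C then out_left (m j) (m (Suc j)) (v j) (v (Suc j))
     else if 0 < j \<and> j - 1 \<in> C then out_right (m (j - 1)) (m j) (v (j - 1)) (v j)
     else v j)"

text \<open>evolves n m q v k: starting from positions q and velocities v (at time 0), the
  n-particle system with masses m undergoes only binary collisions at positive times,
  and exactly k of them (in particular finitely many).\<close>
inductive evolves :: "nat \<Rightarrow> (nat \<Rightarrow> real) \<Rightarrow> (nat \<Rightarrow> real) \<Rightarrow> (nat \<Rightarrow> real) \<Rightarrow> nat \<Rightarrow> bool"
  for n :: nat and m :: "nat \<Rightarrow> real" where
  no_more: "(\<forall>t>0. coll_pairs n q v t = {}) \<Longrightarrow> evolves n m q v 0"
| step: "first_coll_time n q v t \<Longrightarrow> binary_pairs (coll_pairs n q v t) \<Longrightarrow>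
         evolves n m (\<lambda>j. q j + t * v j) (post_vel m (coll_pairs n q v t) v) k \<Longrightarrow>
         evolves n m q v (k + card (coll_pairs n q v t))"

end

theory Submission
  imports Defs
begin

text \<open>
  Let a fast particle cross a resting cluster of \<open>N\<close> particles from the right. By momentum transfer
  it makes \<open>N\<close> collisions, after which the cluster consists of the \<open>N\<close> rightmost particles, with
  small velocities determined by the differences of neighbouring masses. The masses can be chosen
  near \<open>1\<close> such that these velocities are \<open>\<eta>, 2\<eta>, \<dots>, N\<eta>\<close>. As collisions
  between nearly equal masses nearly exchange velocities, the cluster then undergoes as many
  collisions as the velocities have inversions: none for \<open>\<eta> > 0\<close>, and \<open>N choose 2\<close> for
  \<open>\<eta> < 0\<close>. With \<open>N = n - 1\<close> this gives \<open>n - 1\<close> and \<open>n choose 2\<close> collisions. For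
  \<open>(n + 1) choose 3\<close>, take \<open>\<eta> < 0\<close> and let particles \<open>1, \<dots>, n - 1\<close> arrive one after the other,
  each so fast that the cluster to its left, whose collisions are over by then, is at rest in
  comparison; the \<open>N\<close>-th arrival contributes \<open>N + (N choose 2) = (N + 1) choose 2\<close> collisions.
  Triple collisions are avoided by perturbing the positions at each stage.
\<close>

section \<open>Algebra of a single collision\<close>

definition increasing :: "nat \<Rightarrow> (nat \<Rightarrow> real) \<Rightarrow> bool" where
  "increasing n x \<longleftrightarrow> (\<forall>j. Suc j < n \<longrightarrow> x j < x (Suc j))"

text \<open>Applied to positions as well as to velocities. For positive masses it is the orthogonal
  reflection in the hyperplane \<open>x i = x (Suc i)\<close> with respect to the mass-weighted
  inner product.\<close>

abbreviation reflect :: "(nat \<Rightarrow> real) \<Rightarrow> nat \<Rightarrow> (nat \<Rightarrow> real) \<Rightarrow> nat \<Rightarrow> real" where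
  "reflect m i \<equiv> post_vel m {i}"

abbreviation drift :: "(nat \<Rightarrow> real) \<Rightarrow> real \<Rightarrow> (nat \<Rightarrow> real) \<Rightarrow> nat \<Rightarrow> real" where
  "drift q t v \<equiv> (\<lambda>j. q j + t * v j)"

lemma reflect_apply:
  "reflect m i x j =
    (if j = i then out_left (m i) (m (Suc i)) (x i) (x (Suc i))
     else if j = Suc i then out_right (m i) (m (Suc i)) (x i) (x (Suc i)) else x j)"
  by (auto simp: post_vel_def)

lemma reflect_simps:
  "reflect m i x i = out_left (m i) (m (Suc i)) (x i) (x (Suc i))"
  "reflect m i x (Suc i) = out_right (m i) (m (Suc i)) (x i) (x (Suc i))"
  "j \<noteq> i \<Longrightarrow> j \<noteq> Suc i \<Longrightarrow> reflect m i x j = x j"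
  by (auto simp: reflect_apply)

text \<open>In this form, as in \<open>out_right_eq\<close>, a collision exchanges the two
  velocities up to a common correction, proportional to the mass difference.\<close>

lemma out_left_eq:
  "a + b \<noteq> 0 \<Longrightarrow> out_left a b x y = y + (a - b) / (a + b) * (x - y)"
  by (simp add: out_left_def divide_simps) (simp add: algebra_simps)

lemma out_right_eq:
  "a + b \<noteq> 0 \<Longrightarrow> out_right a b x y = x + (a - b) / (a + b) * (x - y)"
  by (simp add: out_right_def divide_simps) (simp add: algebra_simps)

lemma reflect_gap:
  "m i + m (Suc i) \<noteq> 0 \<Longrightarrow>
    reflect m i x (Suc i) - reflect m i x i = x i - x (Suc i)"
  by (simp add: reflect_simps out_left_eq out_right_eq)

lemma reflect_drift:
  "reflect m i (drift x t y) = drift (reflect m i x) t (reflect m i y)"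
  by (auto simp: reflect_apply out_left_def out_right_def add_divide_distrib
      algebra_simps diff_divide_distrib)

lemma reflect_scale:
  "reflect m i (\<lambda>j. c * y j) = (\<lambda>j. c * reflect m i y j)"
  by (auto simp: reflect_apply out_left_def out_right_def add_divide_distrib
      algebra_simps diff_divide_distrib)

text \<open>Collisions are reversible. This allows approximations to be carried backwards through a
  collision.\<close>

lemma reflect_reflect:
  assumes "m i + m (Suc i) \<noteq> 0"
  shows "reflect m i (reflect m i x) = x"
  using assms
  by (auto simp: fun_eq_iff reflect_apply out_left_eq out_right_eq simp flip: add_divide_distrib)
    (simp_all add: algebra_simps)

lemma reflect_fixed:
  assumes "m i + m (Suc i) \<noteq> 0" "x i = x (Suc i)"
  shows "reflect m i x = x"
  using assms by (auto simp: fun_eq_iff reflect_apply out_left_eq out_right_eq)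

lemma reflect_upd:
  "Suc i < N \<Longrightarrow> reflect m i (x(N := y)) = (reflect m i x)(N := y)"
  by (auto simp: fun_eq_iff reflect_apply)

lemma tendsto_reflect:
  assumes "((\<lambda>s. f s i) \<longlongrightarrow> m i) F" "((\<lambda>s. f s (Suc i)) \<longlongrightarrow> m (Suc i)) F"
    and "((\<lambda>s. g s i) \<longlongrightarrow> x i) F" "((\<lambda>s. g s (Suc i)) \<longlongrightarrow> x (Suc i)) F"
    and "((\<lambda>s. g s j) \<longlongrightarrow> x j) F" and "m i + m (Suc i) \<noteq> 0"
  shows "((\<lambda>s. reflect (f s) i (g s) j) \<longlongrightarrow> reflect m i x j) F"
  unfolding reflect_apply out_left_def out_right_def
  by (cases "j = i"; cases "j = Suc i")
    (use assms in \<open>auto intro!: tendsto_intros\<close>)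

lemma continuous_reflect:
  assumes "continuous_on S g"
  shows "continuous_on S (\<lambda>s. reflect m i (g s))"
proof (rule continuous_on_coordinatewise_then_product)
  fix j
  have *: "continuous_on S (\<lambda>s. g s k)" for k
    by (rule continuous_on_product_then_coordinatewise [OF assms])
  show "continuous_on S (\<lambda>s. reflect m i (g s) j)"
    unfolding reflect_apply out_left_def out_right_def divide_inverse
    by (cases "j = i"; cases "j = Suc i") (auto intro!: continuous_intros *)
qed

subsection \<open>Stable collision sequences\<close>

text \<open>The last inequality says that at the time at which particles \<open>i\<close> and \<open>Suc i\<close> meet, the
  particles \<open>j\<close> and \<open>Suc j\<close> have not met yet; it is multiplied by the closing speed
  \<open>v i - v (Suc i)\<close>.\<close>
definition collides_first :: "nat \<Rightarrow> nat \<Rightarrow> (nat \<Rightarrow> real) \<Rightarrow> (nat \<Rightarrow> real) \<Rightarrow> bool" where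
  "collides_first n i q v \<longleftrightarrow> Suc i < n \<and> increasing n q \<and> v (Suc i) < v i \<and>
     (\<forall>j. Suc j < n \<longrightarrow> j \<noteq> i \<longrightarrow>
       0 < (q (Suc j) - q j) * (v i - v (Suc i)) + (q (Suc i) - q i) * (v (Suc j) - v j))"

text \<open>Positions after a collision of \<open>i\<close> and \<open>Suc i\<close> before time \<open>T\<close> are \<open>reflect m i (drift q T v)\<close>,
  since \<open>reflect m i\<close> is linear and fixes the configurations with \<open>q i = q (Suc i)\<close>.\<close>
inductive robust :: "nat \<Rightarrow> (nat \<Rightarrow> real) \<Rightarrow> (nat \<Rightarrow> real) \<Rightarrow> (nat \<Rightarrow> real) \<Rightarrow> nat \<Rightarrow> bool"
  for n :: nat and m :: "nat \<Rightarrow> real" where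
  free: "increasing n q \<Longrightarrow> increasing n v \<Longrightarrow> robust n m q v 0"
| collision: "collides_first n i q v \<Longrightarrow> 0 < T \<Longrightarrow>
    robust n m (reflect m i (drift q T v)) (reflect m i v) k \<Longrightarrow> robust n m q v (Suc k)"

text \<open>Dividing the inequalities of \<open>collides_first\<close> by the positive closing speed
  turns them into positive gaps at the meeting time.\<close>

lemma collides_first_time:
  assumes "collides_first n i q v"
  obtains s where "0 < s" "drift q s v i = drift q s v (Suc i)"
    "\<And>j. Suc j < n \<Longrightarrow> j \<noteq> i \<Longrightarrow> drift q s v j < drift q s v (Suc j)"
proof
  define s where "s = (q (Suc i) - q i) / (v i - v (Suc i))"
  have v: "v (Suc i) < v i" and "q i < q (Suc i)"
    using assms by (auto simp: collides_first_def increasing_def)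
  then show "0 < s" "drift q s v i = drift q s v (Suc i)" by (simp_all add: s_def field_simps)
  fix j assume "Suc j < n" "j \<noteq> i"
  then have "0 < ((q (Suc j) - q j) * (v i - v (Suc i)) + (q (Suc i) - q i) * (v (Suc j) - v j)) /
      (v i - v (Suc i))"
    using assms v by (auto simp: collides_first_def)
  also have "\<dots> = q (Suc j) - q j + s * (v (Suc j) - v j)"
    using v by (simp add: s_def add_divide_distrib)
  finally show "drift q s v j < drift q s v (Suc j)" by (simp add: algebra_simps)
qed

lemma robust_increasing: "robust n m q v k \<Longrightarrow> increasing n q"
  by (erule robust.cases) (auto simp: collides_first_def)

text \<open>\<open>evolves\<close> restarts its clock at each collision, \<open>robust\<close> at a
  chosen later time. Moving the start back over a collision-free interval reconciles the
  two.\<close>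

lemma evolves_drift:
  assumes "evolves n m (drift q d v) v k" "0 \<le> d"
    and no: "\<And>t. 0 < t \<Longrightarrow> t \<le> d \<Longrightarrow> coll_pairs n q v t = {}"
  shows "evolves n m q v k"
proof -
  have shift: "coll_pairs n (drift q d v) v t = coll_pairs n q v (d + t)" for t
    by (auto simp: coll_pairs_def meets_def algebra_simps)
  from assms(1) show ?thesis
  proof cases
    case no_more
    have "coll_pairs n q v t = {}" if "0 < t" for t
      using no[of t] that no_more(2) shift[of "t - d"] by (cases "t \<le> d") auto
    then show ?thesis using no_more(1) evolves.no_more by auto
  next
    case (step t k')
    have drift: "drift (drift q d v) t v = drift q (d + t) v"
      by (auto simp: algebra_simps)
    have "first_coll_time n q v (d + t)"
      unfolding first_coll_time_def
    proof (intro conjI allI impI)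
      show "0 < d + t" "coll_pairs n q v (d + t) \<noteq> {}"
        using step(2) assms(2) shift by (auto simp: first_coll_time_def)
    next
      fix s assume "0 < s \<and> s < d + t"
      then show "coll_pairs n q v s = {}"
        using step(2) no[of s] shift[of "s - d"]
        by (cases "s \<le> d") (auto simp: first_coll_time_def)
    qed
    then show ?thesis
      using evolves.step[of n q v "d + t" m k'] step drift shift by auto
  qed
qed

lemma linear_pos_between:
  fixes a b :: real
  assumes "0 < a" "0 < a + s * b" "0 \<le> t" "t \<le> s"
  shows "0 < a + t * b"
proof (cases "0 \<le> b")
  case True
  then show ?thesis using assms(1,3) by (simp add: add_pos_nonneg)
next
  case False
  then have "s * b \<le> t * b" using assms(4) by (intro mult_right_mono_neg) auto
  then show ?thesis using assms(2) by linarith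
qed

text \<open>At the meeting time \<open>s\<close> the configuration is fixed by
  \<open>reflect m i\<close>, so reflecting the free flight up to \<open>T\<close> gives the true
  positions at \<open>T\<close>. Gaps are affine in time, hence positive between two instants at
  which they are positive; this excludes other collisions up to \<open>T\<close>.\<close>

lemma robust_imp_evolves:
  assumes "robust n m q v k" and m: "\<And>j. j < n \<Longrightarrow> 0 < m j"
  shows "evolves n m q v k"
  using assms(1)
proof induction
  case (free q v)
  have "coll_pairs n q v t = {}" if "0 < t" for t
  proof -
    have "q j + t * v j < q (Suc j) + t * v (Suc j)" if "Suc j < n" for j
      using free that \<open>0 < t\<close>
      by (intro add_strict_mono mult_strict_left_mono) (auto simp: increasing_def)
    then show ?thesis by (force simp: coll_pairs_def meets_def)
  qed
  then show ?case by (auto intro: evolves.no_more)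
next
  case (collision i q v T k)
  define w where "w = reflect m i v"
  have i: "Suc i < n" and q: "\<And>j. Suc j < n \<Longrightarrow> q j < q (Suc j)" and v: "v (Suc i) < v i"
    using collision.hyps(1) by (auto simp: collides_first_def increasing_def)
  have mi: "m i + m (Suc i) \<noteq> 0" using m[of i] m[of "Suc i"] i by simp
  obtain s where s: "0 < s" and meet: "drift q s v i = drift q s v (Suc i)"
    and at_s_less: "\<And>j. Suc j < n \<Longrightarrow> j \<noteq> i \<Longrightarrow> drift q s v j < drift q s v (Suc j)"
    using collides_first_time[OF collision.hyps(1)] by blast
  have gap_s: "q (Suc j) - q j + s * (v (Suc j) - v j) > 0" if "Suc j < n" "j \<noteq> i" for j
    using at_s_less[OF that] by (simp add: algebra_simps)
  have gap_i: "(q (Suc i) + t * v (Suc i)) - (q i + t * v i) = (s - t) * (v i - v (Suc i))" for t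
    using meet by (simp add: algebra_simps)
  have at_s: "coll_pairs n q v s = {i}"
    using gap_s i meet by (force simp: coll_pairs_def meets_def algebra_simps)
  have before: "coll_pairs n q v t = {}" if "0 < t" "t < s" for t
  proof -
    have "\<not> meets q v t j" if j: "Suc j < n" for j
    proof (cases "j = i")
      case True
      have "0 < (s - t) * (v i - v (Suc i))" using v \<open>t < s\<close> by simp
      then show ?thesis using True gap_i[of t] by (simp add: meets_def)
    next
      case False
      have "0 < (q (Suc j) - q j) + t * (v (Suc j) - v j)"
        using linear_pos_between[OF _ gap_s[OF j False], of t] q[OF j] \<open>0 < t\<close> \<open>t < s\<close> by simp
      then show ?thesis by (simp add: meets_def algebra_simps)
    qed
    then show ?thesis by (auto simp: coll_pairs_def)
  qed
  define y where "y = drift q s v"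
  have yi: "y i = y (Suc i)" using meet by (simp add: y_def)
  have end_eq: "reflect m i (drift q T v) = drift y (T - s) w"
  proof -
    have "drift q T v = drift y (T - s) v" by (auto simp: y_def algebra_simps)
    then have "reflect m i (drift q T v) = drift (reflect m i y) (T - s) w"
      unfolding w_def using reflect_drift[of m i y "T - s" v] by simp
    then show ?thesis using reflect_fixed[of m i y] mi yi by simp
  qed
  have inc: "increasing n (drift y (T - s) w)"
    using robust_increasing[OF collision.hyps(3)] end_eq by simp
  \<comment> \<open>The relative velocity is reversed, so the pair can be in order at
    \<open>T\<close> only if \<open>T\<close> lies after the meeting time.\<close>
  have wi: "w (Suc i) - w i = v i - v (Suc i)"
    unfolding w_def by (rule reflect_gap[of m i v]) (rule mi)
  have "0 < (T - s) * (w (Suc i) - w i)"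
    using inc[unfolded increasing_def, rule_format, OF i] yi by (simp add: algebra_simps)
  then have Ts: "s < T" using wi v by (simp add: zero_less_mult_iff)
  have after: "coll_pairs n y w t = {}" if "0 < t" "t \<le> T - s" for t
  proof -
    have "\<not> meets y w t j" if j: "Suc j < n" for j
    proof (cases "j = i")
      case True
      have "0 < t * (w (Suc i) - w i)" using v wi \<open>0 < t\<close> by simp
      then have "y i + t * w i \<noteq> y (Suc i) + t * w (Suc i)"
        unfolding yi right_diff_distrib by linarith
      then show ?thesis using True by (simp add: meets_def)
    next
      case False
      have "0 < (y (Suc j) - y j) + t * (w (Suc j) - w j)"
        by (rule linear_pos_between[of _ "T - s"])
          (use gap_s[OF j False] inc j \<open>0 < t\<close> \<open>t \<le> T - s\<close> in
            \<open>auto simp: y_def increasing_def algebra_simps\<close>)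
      then show ?thesis by (simp add: meets_def algebra_simps)
    qed
    then show ?thesis by (auto simp: coll_pairs_def)
  qed
  have "evolves n m y w k"
    by (rule evolves_drift[of n m y "T - s"])
      (use collision.IH end_eq after Ts in \<open>auto simp: w_def\<close>)
  then have "evolves n m q v (k + card (coll_pairs n q v s))"
    by (intro evolves.step)
      (use s before at_s in \<open>auto simp: first_coll_time_def binary_pairs_def y_def w_def\<close>)
  then show ?case using at_s by simp
qed

section \<open>Persistence of robust collision sequences under perturbation\<close>

lemma eventually_all_less:
  fixes n :: nat
  assumes "\<And>j. j < n \<Longrightarrow> eventually (P j) F"
  shows "eventually (\<lambda>s. \<forall>j<n. P j s) F"
  using eventually_ball_finite[of "{..<n}" "\<lambda>s j. P j s" F] assms
  by (auto elim: eventually_mono)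

lemma eventually_all_Suc_less:
  assumes "\<And>j. Suc j < n \<Longrightarrow> eventually (P j) F"
  shows "eventually (\<lambda>s. \<forall>j. Suc j < n \<longrightarrow> P j s) F"
proof -
  have "eventually (\<lambda>s. \<forall>j<n - 1. P j s) F"
    by (rule eventually_all_less) (use assms in auto)
  then show ?thesis by (rule eventually_mono) auto
qed

lemma tendsto_eventually_less:
  fixes f g :: "'a \<Rightarrow> real"
  assumes "(f \<longlongrightarrow> a) F" "(g \<longlongrightarrow> b) F" "a < b"
  shows "eventually (\<lambda>s. f s < g s) F"
proof -
  have "((\<lambda>s. g s - f s) \<longlongrightarrow> b - a) F" by (intro tendsto_intros assms)
  then have "eventually (\<lambda>s. 0 < g s - f s) F" by (rule order_tendstoD) (use assms in simp)
  then show ?thesis by (rule eventually_mono) simp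
qed

lemma eventually_increasing:
  assumes "\<And>j. j < n \<Longrightarrow> ((\<lambda>s. f s j) \<longlongrightarrow> x j) F" "increasing n x"
  shows "eventually (\<lambda>s. increasing n (f s)) F"
  unfolding increasing_def
  by (rule eventually_all_Suc_less) (use assms in \<open>auto simp: increasing_def intro!: tendsto_eventually_less\<close>)

lemma eventually_collides_first:
  assumes q: "\<And>j. j < n \<Longrightarrow> ((\<lambda>s. g s j) \<longlongrightarrow> q j) F"
    and v: "\<And>j. j < n \<Longrightarrow> ((\<lambda>s. h s j) \<longlongrightarrow> v j) F"
    and c: "collides_first n i q v"
  shows "eventually (\<lambda>s. collides_first n i (g s) (h s)) F"
proof -
  have i: "Suc i < n" using c by (simp add: collides_first_def)
  have "eventually (\<lambda>s. \<forall>j. Suc j < n \<longrightarrow> j \<noteq> i \<longrightarrow>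
       0 < (g s (Suc j) - g s j) * (h s i - h s (Suc i)) + (g s (Suc i) - g s i) * (h s (Suc j) - h s j)) F"
  proof (rule eventually_all_Suc_less)
    fix j assume j: "Suc j < n"
    have "((\<lambda>s. (g s (Suc j) - g s j) * (h s i - h s (Suc i)) + (g s (Suc i) - g s i) * (h s (Suc j) - h s j)) \<longlongrightarrow>
      (q (Suc j) - q j) * (v i - v (Suc i)) + (q (Suc i) - q i) * (v (Suc j) - v j)) F"
      by (intro tendsto_intros q v) (use i j in auto)
    from order_tendstoD(1)[OF this, of 0] show "eventually (\<lambda>s. j \<noteq> i \<longrightarrow>
       0 < (g s (Suc j) - g s j) * (h s i - h s (Suc i)) + (g s (Suc i) - g s i) * (h s (Suc j) - h s j)) F"
      using c j by (cases "j = i") (auto simp: collides_first_def)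
  qed
  moreover have "eventually (\<lambda>s. increasing n (g s)) F"
    using q c by (intro eventually_increasing) (auto simp: collides_first_def)
  moreover have "eventually (\<lambda>s. h s (Suc i) < h s i) F"
    using v[of i] v[of "Suc i"] c by (intro tendsto_eventually_less) (auto simp: collides_first_def)
  ultimately show ?thesis
    by eventually_elim (use i in \<open>auto simp: collides_first_def\<close>)
qed

text \<open>The times \<open>T\<close> are kept while the data vary; what remains are finitely many
  strict inequalities between continuous expressions. The arbitrary filter covers neighbourhoods as
  well as constant families.\<close>

lemma eventually_robust:
  assumes "robust n m q v k" and "\<And>j. j < n \<Longrightarrow> 0 < m j"
    and m: "\<And>j. j < n \<Longrightarrow> ((\<lambda>s. f s j) \<longlongrightarrow> m j) F"
    and "\<And>j. j < n \<Longrightarrow> ((\<lambda>s. g s j) \<longlongrightarrow> q j) F"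
    and "\<And>j. j < n \<Longrightarrow> ((\<lambda>s. h s j) \<longlongrightarrow> v j) F"
  shows "eventually (\<lambda>s. robust n (f s) (g s) (h s) k) F"
  using assms(1,4,5)
proof (induction arbitrary: g h)
  case (free q v)
  have "eventually (\<lambda>s. increasing n (g s)) F" "eventually (\<lambda>s. increasing n (h s)) F"
    using free by (auto intro: eventually_increasing)
  then show ?case by eventually_elim (rule robust.free)
next
  case (collision i q v T k)
  have i: "Suc i < n" using collision.hyps by (simp add: collides_first_def)
  have mi: "m i + m (Suc i) \<noteq> 0" using assms(2)[of i] assms(2)[of "Suc i"] i by simp
  have "eventually (\<lambda>s. robust n (f s) (reflect (f s) i (drift (g s) T (h s))) (reflect (f s) i (h s)) k) F"
    by (rule collision.IH) (rule tendsto_reflect; use i mi m collision.prems in \<open>auto intro!: tendsto_intros\<close>)+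
  moreover have "eventually (\<lambda>s. collides_first n i (g s) (h s)) F"
    by (rule eventually_collides_first) (use collision in auto)
  ultimately show ?case
    by eventually_elim (use collision.hyps(2) robust.collision in blast)
qed

text \<open>Entries at indices beyond \<open>n\<close> are invisible: the primed data, as constant
  families, converge at all indices below \<open>n\<close>. The filter \<open>at 0\<close> only has
  to be nontrivial.\<close>

lemma robust_cong:
  assumes "robust n m q v k" "\<And>j. j < n \<Longrightarrow> 0 < m j"
    and "\<And>j. j < n \<Longrightarrow> m' j = m j" "\<And>j. j < n \<Longrightarrow> q' j = q j" "\<And>j. j < n \<Longrightarrow> v' j = v j"
  shows "robust n m' q' v' k"
  using eventually_robust[OF assms(1,2), of "\<lambda>_. m'" "at (0::real)" "\<lambda>_. q'" "\<lambda>_. v'"] assms(3-5)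
  by simp

lemma tendsto_coordinate:
  fixes q :: "nat \<Rightarrow> real"
  shows "((\<lambda>x. x j) \<longlongrightarrow> q j) (nhds q)"
proof -
  have "continuous_on UNIV (\<lambda>x::nat \<Rightarrow> real. x j)" by simp
  then have "isCont (\<lambda>x::nat \<Rightarrow> real. x j) q"
    by (simp only: continuous_on_eq_continuous_at[OF open_UNIV] UNIV_I Ball_def simp_thms)
  then show ?thesis using tendsto_at_iff_tendsto_nhds[of "\<lambda>x. x j" q] by (simp add: isCont_def)
qed

lemma open_collides_first: "open {q. collides_first n i q v}"
proof (subst open_subopen, intro ballI)
  fix q assume "q \<in> {q. collides_first n i q v}"
  then have "eventually (\<lambda>x. collides_first n i x v) (nhds q)"
    by (intro eventually_collides_first[where q = q and v = v] tendsto_coordinate) auto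
  then show "\<exists>T. open T \<and> q \<in> T \<and> T \<subseteq> {q. collides_first n i q v}"
    unfolding eventually_nhds by auto
qed

text \<open>The continuous map \<open>undo\<close> carries good configurations after the collision
  back to configurations before it. As \<open>collides_first\<close> is an open condition, those
  close enough to \<open>q\<close> begin with the same collision. Closures appear because positions
  may have to be perturbed to avoid simultaneous collisions.\<close>

lemma closure_robust_collision:
  assumes c: "collides_first n i q v" and "0 < T" and mi: "m i + m (Suc i) \<noteq> 0"
    and "reflect m i (drift q T v) \<in> closure {x. robust n m x (reflect m i v) k}"
  shows "q \<in> closure {x. robust n m x v (Suc k)}"
proof -
  define S where "S = {x. robust n m x (reflect m i v) k}"
  define C where "C = {x. collides_first n i x v}"
  define undo where "undo x = drift (reflect m i x) (- T) v" for x
  have undo: "reflect m i (drift (undo x) T v) = x" for x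
    using reflect_reflect[of m i x] mi by (simp add: undo_def)
  have q: "undo (reflect m i (drift q T v)) = q"
    using reflect_reflect[of m i "drift q T v"] mi by (simp add: undo_def)
  have "continuous_on UNIV undo"
    unfolding undo_def
    by (intro continuous_on_coordinatewise_then_product continuous_intros
        continuous_on_product_then_coordinatewise[OF continuous_reflect])
  then have "undo ` closure S \<subseteq> closure (undo ` S)"
    by (rule continuous_image_closure_subset) simp
  moreover have "undo (reflect m i (drift q T v)) \<in> undo ` closure S"
    using assms(4) unfolding S_def by (rule imageI)
  ultimately have "q \<in> closure (undo ` S)"
    unfolding q by (rule subsetD)
  moreover have "open C" unfolding C_def by (rule open_collides_first)
  ultimately have "q \<in> closure (C \<inter> undo ` S)"
    using open_Int_closure_subset[of C "undo ` S"] c by (auto simp: C_def)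
  moreover have "C \<inter> undo ` S \<subseteq> {x. robust n m x v (Suc k)}"
    using undo \<open>0 < T\<close> by (auto simp: C_def S_def intro!: robust.collision)
  ultimately show ?thesis by (meson closure_mono subsetD)
qed

subsection \<open>Collision counts independent of positions\<close>

definition untied :: "nat \<Rightarrow> (nat \<Rightarrow> real) \<Rightarrow> bool" where
  "untied n v \<longleftrightarrow> (\<forall>j. Suc j < n \<longrightarrow> v j \<noteq> v (Suc j))"

text \<open>The positions are forgotten: whichever approaching neighbours collide, there are \<open>k\<close>
  collisions in total. The last two premises let pairs with equal velocities occur only among
  particles that have not collided yet, so that they can be separated by a perturbation.\<close>
inductive forced :: "nat \<Rightarrow> (nat \<Rightarrow> real) \<Rightarrow> (nat \<Rightarrow> real) \<Rightarrow> nat \<Rightarrow> bool"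
  for n :: nat and m :: "nat \<Rightarrow> real" where
  sorted: "(\<And>j. Suc j < n \<Longrightarrow> v j \<le> v (Suc j)) \<Longrightarrow> forced n m v 0"
| descent: "Suc d < n \<Longrightarrow> v (Suc d) < v d \<Longrightarrow>
    (\<And>i. Suc i < n \<Longrightarrow> v (Suc i) < v i \<Longrightarrow> forced n m (reflect m i v) k) \<Longrightarrow>
    (\<And>i. Suc (Suc i) < n \<Longrightarrow> v (Suc (Suc i)) < v (Suc i) \<Longrightarrow>
      reflect m (Suc i) v i \<noteq> reflect m (Suc i) v (Suc i)) \<Longrightarrow>
    (\<And>i. Suc (Suc i) < n \<Longrightarrow> v (Suc i) < v i \<Longrightarrow>
      reflect m i v (Suc i) \<noteq> reflect m i v (Suc (Suc i))) \<Longrightarrow>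
    forced n m v (Suc k)"

text \<open>The colliding pair separates because its relative velocity is reversed; its two
  neighbouring pairs are covered by the last two premises of \<open>descent\<close>.\<close>

lemma reflect_distinct:
  assumes "forced n m v (Suc k)" "Suc i < n" "v (Suc i) < v i" "m i + m (Suc i) \<noteq> 0"
    and "Suc j < n" "j = i \<or> j = Suc i \<or> Suc j = i"
  shows "reflect m i v j \<noteq> reflect m i v (Suc j)"
  using assms(1)
proof cases
  case (descent d)
  consider "j = i" | "j = Suc i" | "i = Suc j" using assms(6) by auto
  then show ?thesis
    using reflect_gap[of m i v] assms descent by cases auto
qed

lemma forced_Suc_reflect:
  assumes "forced n m v (Suc k)" "Suc i < n" "v (Suc i) < v i"
  shows "forced n m (reflect m i v) k"
  using assms by (auto elim: forced.cases)

lemma untied_reflect: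
  assumes "forced n m v (Suc k)" "Suc i < n" "v (Suc i) < v i" "m i + m (Suc i) \<noteq> 0" "untied n v"
  shows "untied n (reflect m i v)"
  unfolding untied_def
proof (intro allI impI)
  fix j assume j: "Suc j < n"
  show "reflect m i v j \<noteq> reflect m i v (Suc j)"
    using reflect_distinct[OF assms(1-4) j] assms(5) j
    by (cases "j = i \<or> j = Suc i \<or> Suc j = i") (auto simp: reflect_simps untied_def)
qed

text \<open>Rescaling velocities changes only the unit of time: \<open>reflect\<close> is linear and
  all conditions on \<open>v\<close> are homogeneous.\<close>

lemma forced_scale:
  assumes "forced n m v k" "0 < c"
  shows "forced n m (\<lambda>j. c * v j) k"
  using assms(1)
proof induction
  case (sorted v)
  then show ?case using \<open>0 < c\<close> by (auto intro!: forced.sorted)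
next
  case (descent d v k)
  show ?case
    by (rule forced.descent[of d]) (use descent \<open>0 < c\<close> in \<open>auto simp: reflect_scale\<close>)
qed

text \<open>Strict inequalities persist near the limit, and the last hypothesis resolves every tie
  of the limit into a pair that does not approach.\<close>

lemma eventually_forced:
  assumes "forced n m v k" and "\<And>j. j < n \<Longrightarrow> 0 < m j"
    and "\<And>j. j < n \<Longrightarrow> ((\<lambda>s. f s j) \<longlongrightarrow> v j) F"
    and "\<And>j. Suc j < n \<Longrightarrow> v j = v (Suc j) \<Longrightarrow> eventually (\<lambda>s. f s j < f s (Suc j)) F"
  shows "eventually (\<lambda>s. forced n m (f s) k) F"
  using assms(1,3,4)
proof (induction arbitrary: f)
  case (sorted v)
  have "eventually (\<lambda>s. \<forall>j. Suc j < n \<longrightarrow> f s j < f s (Suc j)) F"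
  proof (rule eventually_all_Suc_less)
    fix j assume j: "Suc j < n"
    show "eventually (\<lambda>s. f s j < f s (Suc j)) F"
      using sorted(1,3)[OF j] tendsto_eventually_less[OF sorted(2) sorted(2), of j "Suc j"] j
      by (cases "v j = v (Suc j)") auto
  qed
  then show ?case by eventually_elim (auto intro!: forced.sorted less_imp_le)
next
  case (descent d v k)
  have forced_v: "forced n m v (Suc k)"
    using descent.hyps by (rule forced.descent)
  have m: "m i + m (Suc i) \<noteq> 0" if "Suc i < n" for i
    using assms(2)[of i] assms(2)[of "Suc i"] that by simp
  have refl: "((\<lambda>s. reflect m i (f s) j) \<longlongrightarrow> reflect m i v j) F" if "Suc i < n" "j < n" for i j
    by (rule tendsto_reflect) (use m that descent.prems in auto)
  have sign: "eventually (\<lambda>s. \<forall>i. Suc i < n \<longrightarrow> (f s (Suc i) < f s i \<longleftrightarrow> v (Suc i) < v i)) F"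
  proof (rule eventually_all_Suc_less)
    fix i assume i: "Suc i < n"
    consider "v i = v (Suc i)" | "v i < v (Suc i)" | "v (Suc i) < v i" by linarith
    then show "eventually (\<lambda>s. f s (Suc i) < f s i \<longleftrightarrow> v (Suc i) < v i) F"
    proof cases
      case 1
      from descent.prems(2)[OF i 1] show ?thesis by eventually_elim (use 1 in auto)
    next
      case 2
      have "eventually (\<lambda>s. f s i < f s (Suc i)) F"
        by (rule tendsto_eventually_less[OF descent.prems(1) descent.prems(1) 2]) (use i in auto)
      then show ?thesis by eventually_elim (use 2 in auto)
    next
      case 3
      have "eventually (\<lambda>s. f s (Suc i) < f s i) F"
        by (rule tendsto_eventually_less[OF descent.prems(1) descent.prems(1) 3]) (use i in auto)
      then show ?thesis by eventually_elim (use 3 in auto)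
    qed
  qed
  have distinct: "eventually (\<lambda>s. reflect m i (f s) j \<noteq> reflect m i (f s) (Suc j)) F"
    if "Suc i < n" "v (Suc i) < v i" "Suc j < n" "j = i \<or> j = Suc i \<or> Suc j = i" for i j
  proof -
    have "((\<lambda>s. reflect m i (f s) j - reflect m i (f s) (Suc j)) \<longlongrightarrow>
        reflect m i v j - reflect m i v (Suc j)) F"
      by (intro tendsto_diff refl) (use that in auto)
    from tendsto_imp_eventually_ne[OF this, of 0] show ?thesis
      using reflect_distinct[OF forced_v that(1,2) m that(3,4)] that(1) by auto
  qed
  have IH: "eventually (\<lambda>s. forced n m (reflect m i (f s)) k) F" if i: "Suc i < n" "v (Suc i) < v i" for i
  proof (rule descent.IH(1)[OF i])
    show "((\<lambda>s. reflect m i (f s) j) \<longlongrightarrow> reflect m i v j) F" if "j < n" for j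
      using refl i that by auto
    \<comment> \<open>No tie arises at or next to the colliding pair, so a tie after the collision
      is an old one, between particles whose velocities have not changed.\<close>
    fix j assume j: "Suc j < n" and eq: "reflect m i v j = reflect m i v (Suc j)"
    then have ne: "j \<noteq> i" "j \<noteq> Suc i" "Suc j \<noteq> i"
      using reflect_distinct[OF forced_v i m[OF i(1)] j] by blast+
    then have "v j = v (Suc j)" using eq by (simp add: reflect_simps)
    from descent.prems(2)[OF j this]
    show "eventually (\<lambda>s. reflect m i (f s) j < reflect m i (f s) (Suc j)) F"
      using ne by (simp add: reflect_simps)
  qed
  have "eventually (\<lambda>s. \<forall>i. Suc i < n \<longrightarrow> v (Suc i) < v i \<longrightarrow> forced n m (reflect m i (f s)) k) F"
  proof (rule eventually_all_Suc_less)
    fix i assume "Suc i < n"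
    then show "eventually (\<lambda>s. v (Suc i) < v i \<longrightarrow> forced n m (reflect m i (f s)) k) F"
      using IH[of i] by (cases "v (Suc i) < v i") auto
  qed
  moreover have "eventually (\<lambda>s. \<forall>i. Suc i < n \<longrightarrow> Suc (Suc i) < n \<and> v (Suc (Suc i)) < v (Suc i) \<longrightarrow>
      reflect m (Suc i) (f s) i \<noteq> reflect m (Suc i) (f s) (Suc i)) F"
  proof (rule eventually_all_Suc_less)
    fix i assume "Suc i < n"
    then show "eventually (\<lambda>s. Suc (Suc i) < n \<and> v (Suc (Suc i)) < v (Suc i) \<longrightarrow>
        reflect m (Suc i) (f s) i \<noteq> reflect m (Suc i) (f s) (Suc i)) F"
      using distinct[of "Suc i" i] by (cases "Suc (Suc i) < n \<and> v (Suc (Suc i)) < v (Suc i)") auto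
  qed
  moreover have "eventually (\<lambda>s. \<forall>i. Suc i < n \<longrightarrow> Suc (Suc i) < n \<and> v (Suc i) < v i \<longrightarrow>
      reflect m i (f s) (Suc i) \<noteq> reflect m i (f s) (Suc (Suc i))) F"
  proof (rule eventually_all_Suc_less)
    fix i assume "Suc i < n"
    then show "eventually (\<lambda>s. Suc (Suc i) < n \<and> v (Suc i) < v i \<longrightarrow>
        reflect m i (f s) (Suc i) \<noteq> reflect m i (f s) (Suc (Suc i))) F"
      using distinct[of i "Suc i"] by (cases "Suc (Suc i) < n \<and> v (Suc i) < v i") auto
  qed
  ultimately show ?case
    using sign
  proof eventually_elim
    case (elim s)
    show ?case
      by (rule forced.descent[of d]) (use descent.hyps(1,2) elim in auto)
  qed
qed

section \<open>From velocities to robust positions\<close>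

text \<open>Among the approaching neighbours take \<open>i\<close> with the smallest meeting time.
  Moving everything to the right of \<open>i\<close> leftwards by \<open>\<delta>\<close> shortens
  only the gap at \<open>i\<close>, so this pair becomes strictly first.\<close>

lemma exists_unique_first_collision:
  assumes q: "increasing n q" and d: "Suc d < n" "v (Suc d) < v d"
  obtains i where "Suc i < n" "v (Suc i) < v i"
    "\<And>\<delta>. 0 < \<delta> \<Longrightarrow> \<delta> < q (Suc i) - q i \<Longrightarrow>
      collides_first n i (\<lambda>j. if j \<le> i then q j else q j - \<delta>) v"
proof -
  define I where "I = {i. Suc i < n \<and> v (Suc i) < v i}"
  define c where "c i = (q (Suc i) - q i) / (v i - v (Suc i))" for i
  have "finite I" by (rule finite_subset[of _ "{..<n}"]) (auto simp: I_def)
  moreover have "I \<noteq> {}" using d by (auto simp: I_def)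
  ultimately obtain i where i: "i \<in> I" and min: "\<And>j. j \<in> I \<Longrightarrow> c i \<le> c j"
    by (metis arg_min_if_finite(1) arg_min_least)
  have vi: "Suc i < n" "v (Suc i) < v i" using i by (auto simp: I_def)
  have gap: "q j < q (Suc j)" if "Suc j < n" for j using q that by (simp add: increasing_def)
  show thesis
  proof (rule that[OF vi])
    fix \<delta> :: real assume \<delta>: "0 < \<delta>" "\<delta> < q (Suc i) - q i"
    define q' where "q' = (\<lambda>j. if j \<le> i then q j else q j - \<delta>)"
    have gap_i: "q' (Suc i) - q' i = q (Suc i) - q i - \<delta>" by (simp add: q'_def)
    have gap_j: "q' (Suc j) - q' j = q (Suc j) - q j" if "j \<noteq> i" for j
      using that by (auto simp: q'_def)
    have "increasing n q'"
      unfolding increasing_def using gap gap_i gap_j \<delta> by (metis diff_gt_0_iff_gt)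
    moreover have "0 < (q' (Suc j) - q' j) * (v i - v (Suc i)) + (q' (Suc i) - q' i) * (v (Suc j) - v j)"
      if j: "Suc j < n" "j \<noteq> i" for j
    proof (cases "v j \<le> v (Suc j)")
      case True
      then show ?thesis
        unfolding gap_i gap_j[OF j(2)] using gap[OF j(1)] vi \<delta>
        by (intro add_pos_nonneg mult_pos_pos mult_nonneg_nonneg) auto
    next
      case False
      then have "c i \<le> c j" using min j by (auto simp: I_def)
      then have "(q (Suc i) - q i) * (v j - v (Suc j)) \<le> (q (Suc j) - q j) * (v i - v (Suc i))"
        using False vi by (simp add: c_def divide_simps mult.commute split: if_splits)
      moreover have "0 < \<delta> * (v j - v (Suc j))" using \<delta> False by simp
      ultimately show ?thesis unfolding gap_i gap_j[OF j(2)] by (simp add: algebra_simps)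
    qed
    ultimately show "collides_first n i q' v"
      using vi by (simp add: collides_first_def)
  qed
qed

text \<open>Right after the meeting time the colliding pair separates, and the other gaps, positive
  at that time, stay positive by continuity.\<close>

lemma exists_time_after_collision:
  assumes m: "m i + m (Suc i) \<noteq> 0" and c: "collides_first n i q v"
  obtains T where "0 < T" "increasing n (reflect m i (drift q T v))"
proof -
  have i: "Suc i < n" "v (Suc i) < v i" and q: "\<And>j. Suc j < n \<Longrightarrow> q j < q (Suc j)"
    using c by (auto simp: collides_first_def increasing_def)
  obtain s where s: "0 < s" and meet: "drift q s v i = drift q s v (Suc i)"
    and less: "\<And>j. Suc j < n \<Longrightarrow> j \<noteq> i \<Longrightarrow> drift q s v j < drift q s v (Suc j)"
    using collides_first_time[OF c] by blast
  have "eventually (\<lambda>T. \<forall>j. Suc j < n \<longrightarrow>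
      reflect m i (drift q T v) j < reflect m i (drift q T v) (Suc j)) (at_right s)"
  proof (rule eventually_all_Suc_less)
    fix j assume j: "Suc j < n"
    show "eventually (\<lambda>T. reflect m i (drift q T v) j < reflect m i (drift q T v) (Suc j)) (at_right s)"
    proof (cases "j = i")
      case True
      have "reflect m i (drift q T v) i < reflect m i (drift q T v) (Suc i)" if "s < T" for T
      proof -
        have "0 < (T - s) * (v i - v (Suc i))" using that i by simp
        then have "0 < drift q T v i - drift q T v (Suc i)" using meet by (simp add: algebra_simps)
        then show ?thesis using reflect_gap[of m i "drift q T v"] m by linarith
      qed
      then show ?thesis using True by (auto simp: eventually_at_filter)
    next
      case False
      have lim: "((\<lambda>T. reflect m i (drift q T v) l) \<longlongrightarrow> drift q s v l) (at_right s)" for l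
      proof -
        have "((\<lambda>T. reflect m i (drift q T v) l) \<longlongrightarrow> reflect m i (drift q s v) l) (at_right s)"
          by (rule tendsto_reflect) (use m in \<open>auto intro!: tendsto_intros\<close>)
        then show ?thesis using reflect_fixed[OF m meet] by simp
      qed
      show ?thesis by (rule tendsto_eventually_less[OF lim lim less[OF j False]])
    qed
  qed
  moreover have "eventually (\<lambda>T. s < T) (at_right s)" by (simp add: eventually_at_filter)
  ultimately have "eventually (\<lambda>T. s < T \<and> increasing n (reflect m i (drift q T v))) (at_right s)"
    unfolding increasing_def by eventually_elim simp
  then obtain T where "s < T" and inc: "increasing n (reflect m i (drift q T v))"
    by (metis (mono_tags, lifting) eventually_happens trivial_limit_at_right_real)
  then have "0 < T" using s by linarith
  then show thesis using inc by (rule that)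
qed

text \<open>Perturb \<open>q\<close> to \<open>p \<delta>\<close> so that the first collision is
  unique, use the induction hypothesis after that collision, and pull back with
  \<open>closure_robust_collision\<close>. Letting \<open>\<delta>\<close> tend to 0 reaches
  \<open>q\<close>, as closures are closed.\<close>

lemma forced_closure_robust:
  assumes m: "\<And>j. j < n \<Longrightarrow> 0 < m j"
  shows "forced n m v k \<Longrightarrow> untied n v \<Longrightarrow> increasing n q \<Longrightarrow> q \<in> closure {x. robust n m x v k}"
proof (induction k arbitrary: v q)
  case 0
  from 0(1) have "\<And>j. Suc j < n \<Longrightarrow> v j \<le> v (Suc j)" by cases auto
  then have "increasing n v" using 0(2) by (force simp: increasing_def untied_def)
  then show ?case using 0(3) by (intro closure_subset[THEN subsetD]) (auto intro: robust.free)
next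
  case (Suc k)
  obtain d where d: "Suc d < n" "v (Suc d) < v d" using Suc.prems(1) by cases auto
  obtain i where i: "Suc i < n" "v (Suc i) < v i"
    and coll: "\<And>\<delta>. 0 < \<delta> \<Longrightarrow> \<delta> < q (Suc i) - q i \<Longrightarrow>
      collides_first n i (\<lambda>j. if j \<le> i then q j else q j - \<delta>) v"
    using exists_unique_first_collision[of n q d v] Suc.prems(3) d by blast
  have mi: "m i + m (Suc i) \<noteq> 0" using m[of i] m[of "Suc i"] i by simp
  define p where "p \<delta> = (\<lambda>j. if j \<le> i then q j else q j - \<delta>)" for \<delta> :: real
  have mem: "p \<delta> \<in> closure {x. robust n m x v (Suc k)}" if "0 < \<delta>" "\<delta> < q (Suc i) - q i" for \<delta>
  proof -
    have c: "collides_first n i (p \<delta>) v" unfolding p_def by (rule coll[OF that])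
    obtain T where T: "0 < T" "increasing n (reflect m i (drift (p \<delta>) T v))"
      by (rule exists_time_after_collision[OF mi c])
    have "reflect m i (drift (p \<delta>) T v) \<in> closure {x. robust n m x (reflect m i v) k}"
      by (rule Suc.IH)
        (use T Suc.prems i mi in \<open>auto intro: forced_Suc_reflect untied_reflect\<close>)
    then show ?thesis by (rule closure_robust_collision[OF c T(1) mi])
  qed
  have "continuous_on UNIV p"
    unfolding p_def
  proof (rule continuous_on_coordinatewise_then_product)
    fix j show "continuous_on UNIV (\<lambda>\<delta>. if j \<le> i then q j else q j - \<delta>)"
      by (cases "j \<le> i") (auto intro!: continuous_intros)
  qed
  then have "(p \<longlongrightarrow> p 0) (at 0)" by (simp add: continuous_on_def)
  then have "(p \<longlongrightarrow> p 0) (at_right 0)" by (rule filterlim_mono) (auto intro: at_le)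
  moreover have "p 0 = q" by (auto simp: p_def)
  moreover have "eventually (\<lambda>\<delta>. p \<delta> \<in> closure {x. robust n m x v (Suc k)}) (at_right 0)"
  proof -
    have "0 < q (Suc i) - q i" using Suc.prems(3) i by (simp add: increasing_def)
    then have "eventually (\<lambda>\<delta>. \<delta> \<in> {0<..<q (Suc i) - q i}) (at_right 0)"
      by (rule eventually_at_right_real)
    then show ?thesis by eventually_elim (use mem in auto)
  qed
  ultimately show ?case
    using Lim_in_closed_set[of "closure {x. robust n m x v (Suc k)}" p "at_right 0" q] by simp
qed

subsection \<open>Adding a fast particle\<close>

lemma increasing_upd:
  assumes "increasing N q" "\<And>j. j < N \<Longrightarrow> q j < p"
  shows "increasing (Suc N) (q(N := p))"
  using assms by (auto simp: increasing_def less_Suc_eq)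

text \<open>\<open>T\<close> is the sum of the times in the \<open>robust\<close> derivation, and
  \<open>q'\<close>, \<open>v'\<close> are the state of the cluster by then. A particle starting at
  \<open>P + V * T\<close> with velocity \<open>- V\<close> is at \<open>P\<close> at that time, so
  the old collisions take place first. \<open>T\<close> and \<open>B\<close> do not depend on
  \<open>V\<close>, which can therefore be chosen once \<open>v'\<close> is known.\<close>

lemma robust_append_fast:
  assumes "robust N m q v k" and m: "\<And>j. j < N \<Longrightarrow> 0 < m j"
  shows "\<exists>T\<ge>0. \<exists>B q' v'. increasing N q' \<and> increasing N v' \<and> (\<forall>j<N. q' j \<le> B) \<and>
    (\<forall>P>B. \<forall>V>0. \<forall>l. q'(N := P) \<in> closure {x. robust (Suc N) m x (v'(N := - V)) l} \<longrightarrow>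
      q(N := P + V * T) \<in> closure {x. robust (Suc N) m x (v(N := - V)) (k + l)})"
  using assms(1)
proof induction
  case (free q v)
  have "\<forall>j<N. q j \<le> Max (q ` {..<N})" by auto
  then show ?case
    by (intro exI[of _ "0::real"] exI[of _ "Max (q ` {..<N})"] exI[of _ q] exI[of _ v] conjI free)
      auto
next
  case (collision i q v T k)
  define p w where "p = reflect m i (drift q T v)" and "w = reflect m i v"
  obtain T0 B q' v' where T0: "0 \<le> T0" and inc: "increasing N q'" "increasing N v'"
    and B: "\<And>j. j < N \<Longrightarrow> q' j \<le> B"
    and IH: "\<And>P V l. B < P \<Longrightarrow> 0 < V \<Longrightarrow> q'(N := P) \<in> closure {x. robust (Suc N) m x (v'(N := - V)) l} \<Longrightarrow>
      p(N := P + V * T0) \<in> closure {x. robust (Suc N) m x (w(N := - V)) (k + l)}"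
    using collision.IH unfolding p_def w_def by blast
  have i: "Suc i < N" and v: "v (Suc i) < v i" and q: "increasing N q"
    using collision.hyps(1) by (auto simp: collides_first_def)
  have mi: "m i + m (Suc i) \<noteq> 0" using m[of i] m[of "Suc i"] i by simp
  define gap where "gap = q (Suc i) - q i"
  define rate where "rate = v i - v (Suc i)"
  have rate: "0 < rate" using v by (simp add: rate_def)
  have "p i < p (Suc i)"
    using robust_increasing[OF collision.hyps(3)] i by (simp add: p_def increasing_def)
  \<comment> \<open>Order after the reflection means that free flight has inverted the pair by time
    \<open>T\<close>: its meeting time \<open>gap / rate\<close> is less than
    \<open>T\<close>.\<close>
  then have gap: "gap < T * rate"
    using reflect_gap[of m i "drift q T v"] mi by (simp add: p_def gap_def rate_def algebra_simps)
  \<comment> \<open>\<open>C j\<close> bounds particle \<open>j\<close> at the start and at the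
    meeting time of the pair at \<open>i\<close>; a new particle beyond these bounds does not
    interfere with that collision.\<close>
  define C where "C j = max (q j) (q j + gap / rate * v j)" for j
  define B' where "B' = max B (Max (C ` {..<N}))"
  have "C j \<le> B'" if "j < N" for j using that by (auto simp: B'_def max.coboundedI2)
  then have B': "q j \<le> B'" "q j + gap / rate * v j \<le> B'" if "j < N" for j
    using that unfolding C_def by force+
  have "q(N := P + V * (T0 + T)) \<in> closure {x. robust (Suc N) m x (v(N := - V)) (Suc k + l)}"
    if P: "B' < P" and V: "0 < V"
      and mem: "q'(N := P) \<in> closure {x. robust (Suc N) m x (v'(N := - V)) l}" for P V l
  proof -
    define q1 v1 where "q1 = q(N := P + V * (T0 + T))" and "v1 = v(N := - V)"
    have VT: "0 \<le> V * (T0 + T)" using V T0 collision.hyps(2) by simp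
    have "increasing (Suc N) q1"
      unfolding q1_def using q by (rule increasing_upd) (use B' P VT in force)
    moreover have "0 < (q1 (Suc j) - q1 j) * (v1 i - v1 (Suc i)) + (q1 (Suc i) - q1 i) * (v1 (Suc j) - v1 j)"
      if j: "Suc j < Suc N" "j \<noteq> i" for j
    proof (cases "Suc j = N")
      case True
      \<comment> \<open>The distance from particle \<open>j\<close> to \<open>P\<close> at the
        meeting time, multiplied by the closing speed. The two estimates that follow express that
        the new particle has not passed \<open>P\<close> by then.\<close>
      have "0 < (P - (q j + gap / rate * v j)) * rate"
        using B'(2)[of j] P True rate by (intro mult_pos_pos) auto
      also have "\<dots> = P * rate - q j * rate - gap * v j" using rate by (simp add: field_simps)
      finally have "0 < P * rate - q j * rate - gap * v j" .
      moreover have "V * gap \<le> V * (T * rate)" using gap V by simp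
      moreover have "0 \<le> V * (T0 * rate)" using T0 V rate by simp
      ultimately show ?thesis
        using True i by (simp add: q1_def v1_def gap_def[symmetric] rate_def[symmetric])
          (simp add: algebra_simps)
    next
      case False
      then show ?thesis
        using collision.hyps(1) j i by (simp add: q1_def v1_def collides_first_def)
    qed
    ultimately have c: "collides_first (Suc N) i q1 v1"
      using i v by (simp add: collides_first_def v1_def)
    have "drift q1 T v1 = (drift q T v)(N := P + V * T0)"
      by (auto simp: q1_def v1_def algebra_simps)
    then have "reflect m i (drift q1 T v1) = p(N := P + V * T0)"
      using i by (simp add: reflect_upd p_def)
    moreover have "reflect m i v1 = w(N := - V)"
      using i by (simp add: reflect_upd v1_def w_def)
    moreover have "p(N := P + V * T0) \<in> closure {x. robust (Suc N) m x (w(N := - V)) (k + l)}"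
      using P V mem by (intro IH) (auto simp: B'_def)
    ultimately have "q1 \<in> closure {x. robust (Suc N) m x v1 (Suc (k + l))}"
      by (intro closure_robust_collision[OF c collision.hyps(2) mi]) simp
    then show ?thesis by (simp add: q1_def v1_def)
  qed
  moreover have "\<forall>j<N. q' j \<le> B'" using B unfolding B'_def by (auto simp: max.coboundedI1)
  moreover have "0 \<le> T0 + T" using T0 collision.hyps(2) by simp
  ultimately show ?case using inc by blast
qed

subsection \<open>A fast particle crossing a cluster\<close>

text \<open>Index 0 is excluded: the fast particle ends up there, to the left of all others.\<close>

definition inversions :: "nat \<Rightarrow> (nat \<Rightarrow> real) \<Rightarrow> (nat \<times> nat) set" where
  "inversions N z = {(a, b). 0 < a \<and> a < b \<and> b \<le> N \<and> z b < z a}"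

text \<open>\<open>k\<close> stands for the number of swaps still to come. Each shifts two entries
  by a common error of at most \<open>E\<close>, so sizes and differences change by at most
  \<open>E\<close>; with the reserve \<open>k * E\<close> the bound \<open>D\<close> and the
  distinctness of the entries survive all of them.\<close>

definition dispersed :: "nat \<Rightarrow> real \<Rightarrow> real \<Rightarrow> (nat \<Rightarrow> real) \<Rightarrow> nat \<Rightarrow> bool" where
  "dispersed N D E z k \<longleftrightarrow> (\<forall>j. 0 < j \<and> j \<le> N \<longrightarrow> \<bar>z j\<bar> + k * E \<le> D) \<and>
     (\<forall>a b. 0 < a \<and> a \<le> N \<and> 0 < b \<and> b \<le> N \<and> a \<noteq> b \<longrightarrow> k * E < \<bar>z a - z b\<bar>)"

lemma finite_inversions: "finite (inversions N z)"
  by (rule finite_subset[of _ "{..N} \<times> {..N}"]) (auto simp: inversions_def)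

text \<open>The transposition \<open>t\<close> of \<open>d\<close> and \<open>Suc d\<close> maps the
  inversions of \<open>z'\<close> bijectively onto those of \<open>z\<close> other than
  \<open>(d, Suc d)\<close>: entries are further apart than the error, so no comparison changes
  beyond the swap itself.\<close>

lemma inversions_swap:
  assumes d: "0 < d" "Suc d \<le> N" "z (Suc d) < z d"
    and z': "z' d = z (Suc d) + e" "z' (Suc d) = z d + e" "\<And>a. a \<noteq> d \<Longrightarrow> a \<noteq> Suc d \<Longrightarrow> z' a = z a"
    and e: "\<bar>e\<bar> \<le> E" and disp: "dispersed N D E z (Suc k)"
  shows "card (inversions N z) = Suc (card (inversions N z'))" "dispersed N D E z' k"
proof -
  define t where "t a = (if a = d then Suc d else if a = Suc d then d else a)" for a
  define c where "c a = (if a = d \<or> a = Suc d then e else 0)" for a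
  have z'_eq: "z' a = z (t a) + c a" for a using z' by (auto simp: t_def c_def)
  have t: "0 < t a" "t a \<le> N" if "0 < a" "a \<le> N" for a using that d by (auto simp: t_def)
  have t_inj: "t a \<noteq> t b" if "a \<noteq> b" for a b using that by (auto simp: t_def)
  have E: "0 \<le> E" using e by linarith
  have c: "\<bar>c a\<bar> \<le> E" "\<bar>c a - c b\<bar> \<le> E" for a b using e by (auto simp: c_def)
  have sep: "k * E + E < \<bar>z (t a) - z (t b)\<bar>" if "0 < a" "a \<le> N" "0 < b" "b \<le> N" "a \<noteq> b" for a b
    using disp t t_inj that by (auto simp: dispersed_def algebra_simps)
  have "k * E \<ge> 0" using E by simp
  have sign: "z' b < z' a \<longleftrightarrow> z (t b) < z (t a)" if "0 < a" "a \<le> N" "0 < b" "b \<le> N" "a \<noteq> b" for a b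
    using sep[OF that] c(2)[of a b] \<open>k * E \<ge> 0\<close> unfolding z'_eq by linarith
  show "dispersed N D E z' k"
    unfolding dispersed_def
  proof (intro conjI allI impI)
    fix j assume j: "0 < j \<and> j \<le> N"
    then have "\<bar>z (t j)\<bar> + (k * E + E) \<le> D"
      using disp t by (auto simp: dispersed_def algebra_simps)
    then show "\<bar>z' j\<bar> + k * E \<le> D" using c(1)[of j] unfolding z'_eq by linarith
  next
    fix a b assume "0 < a \<and> a \<le> N \<and> 0 < b \<and> b \<le> N \<and> a \<noteq> b"
    then show "k * E < \<bar>z' a - z' b\<bar>" using sep[of a b] c(2)[of a b] unfolding z'_eq by linarith
  qed
  define f where "f = (\<lambda>(a, b). (t a, t b))"
  have t_mono: "t a < t b" if "a < b" "(a, b) \<noteq> (d, Suc d)" for a b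
    using that by (auto simp: t_def)
  have tt: "t (t a) = a" for a by (auto simp: t_def)
  have td: "t a = d \<longleftrightarrow> a = Suc d" "t a = Suc d \<longleftrightarrow> a = d" for a by (auto simp: t_def)
  have swapped: "\<not> z' (Suc d) < z' d" using z' d by simp
  have "bij_betw f (inversions N z') (inversions N z - {(d, Suc d)})"
  proof (rule bij_betw_byWitness[where f' = f])
    show "\<forall>x\<in>inversions N z'. f (f x) = x" "\<forall>x\<in>inversions N z - {(d, Suc d)}. f (f x) = x"
      by (auto simp: f_def tt)
    show "f ` inversions N z' \<subseteq> inversions N z - {(d, Suc d)}"
    proof
      fix x assume "x \<in> f ` inversions N z'"
      then obtain a b where ab: "0 < a" "a < b" "b \<le> N" "z' b < z' a" and x: "x = (t a, t b)"
        by (auto simp: f_def inversions_def)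
      then have "(a, b) \<noteq> (d, Suc d)" using swapped by auto
      then show "x \<in> inversions N z - {(d, Suc d)}"
        using ab t[of a] t[of b] t_mono[of a b] sign[of a b] by (auto simp: x inversions_def td)
    qed
    show "f ` (inversions N z - {(d, Suc d)}) \<subseteq> inversions N z'"
    proof
      fix x assume "x \<in> f ` (inversions N z - {(d, Suc d)})"
      then obtain a b where ab: "(a, b) \<noteq> (d, Suc d)" "0 < a" "a < b" "b \<le> N" "z b < z a"
        and x: "x = (t a, t b)"
        by (auto simp: f_def inversions_def)
      then show "x \<in> inversions N z'"
        using t[of a] t[of b] t_mono[of a b] sign[of "t a" "t b"] t_inj[of a b]
        by (auto simp: x inversions_def tt)
    qed
  qed
  then have "card (inversions N z') = card (inversions N z - {(d, Suc d)})"
    by (rule bij_betw_same_card)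
  moreover have "(d, Suc d) \<in> inversions N z" using d by (auto simp: inversions_def)
  ultimately show "card (inversions N z) = Suc (card (inversions N z'))"
    using card_Suc_Diff1[OF finite_inversions] by metis
qed

lemma dispersed_bound:
  assumes "dispersed N D E z k" "0 \<le> E" "0 < j" "j \<le> N"
  shows "\<bar>z j\<bar> \<le> D"
proof -
  have "\<bar>z j\<bar> + k * E \<le> D" using assms(1,3,4) unfolding dispersed_def by blast
  moreover have "0 \<le> k * E" using assms(2) by simp
  ultimately show ?thesis by linarith
qed

lemma dispersed_distinct:
  assumes "dispersed N D E z k" "0 \<le> E" "0 < a" "a \<le> N" "0 < b" "b \<le> N" "a \<noteq> b"
  shows "z a \<noteq> z b"
proof -
  have "k * E < \<bar>z a - z b\<bar>" using assms(1,3-) unfolding dispersed_def by blast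
  moreover have "0 \<le> k * E" using assms(2) by simp
  ultimately show ?thesis by auto
qed

lemma inversion_adjacent:
  "(d, Suc d) \<in> inversions N z \<longleftrightarrow> 0 < d \<and> Suc d \<le> N \<and> z (Suc d) < z d"
  by (auto simp: inversions_def)

lemma inversion_imp_descent:
  assumes "(a, b) \<in> inversions N z"
  shows "\<exists>d. 0 < d \<and> Suc d \<le> N \<and> z (Suc d) < z d"
proof (rule ccontr)
  assume "\<not> ?thesis"
  then have mono: "z d \<le> z (Suc d)" if "0 < d" "Suc d \<le> N" for d
    using that not_le by blast
  have ab: "0 < a" "a \<le> b" "b \<le> N" "z b < z a" using assms by (auto simp: inversions_def)
  have "z a \<le> z b"
    using ab(2,3)
  proof (induction b rule: dec_induct)
    case (step c)
    then have "z a \<le> z c" "z c \<le> z (Suc c)" using mono[of c] ab(1) by simp_all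
    then show ?case by (rule order_trans)
  qed simp
  then show False using ab(4) by simp
qed

text \<open>A fast particle crosses particles at rest from right to left: it is at index \<open>i\<close> with
  velocity \<open>- V i\<close>, and leaves velocity \<open>V i - V (i - 1)\<close> behind when it hits the next one.
  Assigning that future velocity to the index \<open>i\<close> already now makes the number of inversions
  of \<open>z\<close> insensitive to collisions of the fast particle.\<close>
lemma forced_pass:
  fixes m V :: "nat \<Rightarrow> real"
  assumes m: "\<And>j. j \<le> N \<Longrightarrow> 0 < m j"
    and V: "\<And>j. j < N \<Longrightarrow> (m j + m (Suc j)) * V j = 2 * m (Suc j) * V (Suc j)"
    and D: "0 \<le> D" "\<And>j. j \<le> N \<Longrightarrow> D < V j"
    and E: "\<And>j. j < N \<Longrightarrow> \<bar>m j - m (Suc j)\<bar> * (2 * D) \<le> E * (m j + m (Suc j))" "0 \<le> E"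
  shows "i \<le> N \<Longrightarrow> (\<And>j. j < i \<Longrightarrow> v j = 0) \<Longrightarrow> v i = - V i \<Longrightarrow>
    (\<And>j. z j = (if j \<le> i then V j - V (j - 1) else v j)) \<Longrightarrow>
    dispersed N D E z k \<Longrightarrow> k = card (inversions N z) \<Longrightarrow> i + k = l \<Longrightarrow> forced (Suc N) m v l"
proof (induction l arbitrary: i k v z)
  case 0
  \<comment> \<open>Here the fast particle has reached index 0 and no inversion is left, so the
    velocities are sorted.\<close>
  have "card (inversions N z) = 0" using "0.prems"(6,7) by linarith
  then have "inversions N z = {}" using finite_inversions by simp
  then have mono: "z j \<le> z (Suc j)" if "0 < j" "Suc j \<le> N" for j
    using inversion_adjacent[of j N z] that by fastforce
  show ?case
  proof (rule forced.sorted)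
    fix j assume j: "Suc j < Suc N"
    show "v j \<le> v (Suc j)"
    proof (cases "j = 0")
      case True
      have "\<bar>z 1\<bar> \<le> D" by (rule dispersed_bound[OF "0.prems"(5) E(2)]) (use j True in auto)
      moreover have "v 0 = - V 0" "v 1 = z 1" using "0.prems"(3,4,7) by auto
      ultimately show ?thesis using True D(2)[of 0] by simp
    next
      case False
      then show ?thesis using mono[of j] "0.prems"(4,7) j by simp
    qed
  qed
next
  case (Suc l)
  note i = Suc.prems(1) and rest = Suc.prems(2) and fast = Suc.prems(3) and z = Suc.prems(4)
    and disp = Suc.prems(5) and k = Suc.prems(6) and l = Suc.prems(7)
  note bound = dispersed_bound[OF disp E(2)] and distinct = dispersed_distinct[OF disp E(2)]
  \<comment> \<open>Only two kinds of collision are possible: the fast particle hits its left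
    neighbour, or an adjacent inversion to its right is resolved. The fast particle outruns its
    right neighbour since \<open>D < V i\<close>.\<close>
  have cases: "i = Suc d \<or> i < d \<and> z (Suc d) < z d" if "Suc d < Suc N" "v (Suc d) < v d" for d
  proof -
    consider "Suc d < i" | "i = Suc d" | "i = d" | "i < d" by linarith
    then show ?thesis
    proof cases
      case 1
      then show ?thesis using rest[of d] rest[of "Suc d"] that by simp
    next
      case 3
      then have "\<bar>v (Suc d)\<bar> \<le> D" using bound[of "Suc d"] that(1) z[of "Suc d"] by simp
      then show ?thesis using 3 that fast D(2)[of i] i by simp
    next
      case 4
      then show ?thesis using z[of d] z[of "Suc d"] that by simp
    qed simp
  qed
  \<comment> \<open>The fast particle moves on by one index. Since \<open>z\<close> already contains
    the velocity left behind, \<open>z\<close> and \<open>k\<close> stay the same and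
    \<open>i\<close> drops by one.\<close>
  have pass: "forced (Suc N) m (reflect m d v) l"
    "\<And>d'. d = Suc d' \<Longrightarrow> reflect m d v d' \<noteq> reflect m d v d"
    "Suc (Suc d) < Suc N \<Longrightarrow> reflect m d v (Suc d) \<noteq> reflect m d v (Suc (Suc d))"
    if d: "i = Suc d" for d
  proof -
    define w where "w = reflect m d v"
    have md: "0 < m d + m i" using m[of d] m[of i] d i by simp
    have Vd: "(m d + m i) * V d = 2 * m i * V i" using V[of d] d i by simp
    have "w d = - V d"
      using Vd md fast rest[of d] d by (simp add: w_def reflect_simps out_left_def field_simps)
    moreover have wi: "w i = V i - V d"
      using Vd md fast rest[of d] d by (simp add: w_def reflect_simps out_right_def field_simps)
    moreover have w: "w j = v j" if "j \<noteq> d" "j \<noteq> i" for j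
      using that d by (simp add: w_def reflect_simps)
    moreover have z_w: "z j = (if j \<le> d then V j - V (j - 1) else w j)" for j
      using z[of j] w[of j] wi d by (cases "j = i") auto
    ultimately show "forced (Suc N) m w l"
      using rest d i l k disp by (intro Suc.IH[of d w z k]) auto
    show "w d' \<noteq> w d" if "d = Suc d'" for d'
      using \<open>w d = - V d\<close> w[of d'] rest[of d'] D(1) D(2)[of d] d i that by simp
    show "w (Suc d) \<noteq> w (Suc (Suc d))" if "Suc (Suc d) < Suc N"
      using distinct[of "Suc d" "Suc (Suc d)"] that z_w[of "Suc d"] z_w[of "Suc (Suc d)"] by simp
  qed
  \<comment> \<open>The two velocities are exchanged up to the error \<open>e\<close>: one inversion
    disappears, so \<open>k\<close> drops by one and \<open>i\<close> stays the same.\<close>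
  have sort: "forced (Suc N) m (reflect m d v) l"
    "\<And>d'. d = Suc d' \<Longrightarrow> reflect m d v d' \<noteq> reflect m d v d"
    "Suc (Suc d) < Suc N \<Longrightarrow> reflect m d v (Suc d) \<noteq> reflect m d v (Suc (Suc d))"
    if d: "i < d" "z (Suc d) < z d" "Suc d < Suc N" for d
  proof -
    define w where "w = reflect m d v"
    define e where "e = (m d - m (Suc d)) / (m d + m (Suc d)) * (v d - v (Suc d))"
    define z' where "z' j = (if j \<le> i then V j - V (j - 1) else w j)" for j
    have md: "0 < m d + m (Suc d)" using m[of d] m[of "Suc d"] d by simp
    \<comment> \<open>This bound on the relative speed is the origin of the factor
      \<open>2 * D\<close> in the assumption on \<open>E\<close>.\<close>
    have "\<bar>v d - v (Suc d)\<bar> \<le> 2 * D"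
      using bound[of d] bound[of "Suc d"] z[of d] z[of "Suc d"] d by simp
    then have "\<bar>m d - m (Suc d)\<bar> * \<bar>v d - v (Suc d)\<bar> \<le> E * (m d + m (Suc d))"
      using E(1)[of d] d mult_left_mono[of "\<bar>v d - v (Suc d)\<bar>" "2 * D" "\<bar>m d - m (Suc d)\<bar>"]
      by simp
    then have e: "\<bar>e\<bar> \<le> E" using md by (simp add: e_def abs_mult divide_simps)
    have w: "w d = v (Suc d) + e" "w (Suc d) = v d + e"
      using md by (simp_all add: w_def e_def reflect_simps out_left_eq out_right_eq)
    have "(d, Suc d) \<in> inversions N z" using d by (simp add: inversion_adjacent)
    then have "card (inversions N z) \<noteq> 0" using finite_inversions[of N z] by auto
    then obtain k' where k': "k = Suc k'" using k not0_implies_Suc by metis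
    have z': "z' d = z (Suc d) + e" "z' (Suc d) = z d + e"
      using w d z[of d] z[of "Suc d"] by (simp_all add: z'_def)
    have "z' a = z a" if "a \<noteq> d" "a \<noteq> Suc d" for a
      using that z[of a] by (simp add: z'_def w_def reflect_simps)
    moreover have "0 < d" "Suc d \<le> N" using d by simp_all
    ultimately have swap: "card (inversions N z) = Suc (card (inversions N z'))" "dispersed N D E z' k'"
      using inversions_swap[OF _ _ d(2) z' _ e, of N D k'] disp k' by blast+
    note bound' = dispersed_bound[OF swap(2) E(2)] and distinct' = dispersed_distinct[OF swap(2) E(2)]
    have w_same: "w j = v j" if "j \<le> i" for j using that d by (simp add: w_def reflect_simps)
    show "forced (Suc N) m w l"
    proof (rule Suc.IH[of i w z' k', OF i])
      show "w j = 0" if "j < i" for j using rest w_same that by simp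
      show "w i = - V i" using fast w_same by simp
      show "z' j = (if j \<le> i then V j - V (j - 1) else w j)" for j by (simp add: z'_def)
      show "dispersed N D E z' k'" by (rule swap)
      show "k' = card (inversions N z')" "i + k' = l" using swap(1) k k' l by simp_all
    qed
    show "w d' \<noteq> w d" if "d = Suc d'" for d'
    proof (cases "d' = i")
      \<comment> \<open>The left neighbour is the fast particle, whose velocity \<open>z'\<close>
        does not record; it is told apart by its speed, which exceeds \<open>D\<close>.\<close>
      case True
      have "\<bar>w d\<bar> \<le> D" using bound'[of d] d by (simp add: z'_def)
      then show ?thesis using True w_same[of i] fast D(2)[of i] i by simp
    next
      case False
      then show ?thesis using distinct'[of d' d] that d by (simp add: z'_def)
    qed
    show "w (Suc d) \<noteq> w (Suc (Suc d))" if "Suc (Suc d) < Suc N"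
      using distinct'[of "Suc d" "Suc (Suc d)"] that d by (simp add: z'_def)
  qed
  have "\<exists>d. Suc d < Suc N \<and> v (Suc d) < v d"
  proof (cases i)
    case 0
    then have "inversions N z \<noteq> {}" using l k by auto
    then obtain a b where "(a, b) \<in> inversions N z" by auto
    from inversion_imp_descent[OF this] obtain d where "0 < d" "Suc d \<le> N" "z (Suc d) < z d"
      by blast
    then show ?thesis using z[of d] z[of "Suc d"] 0 by (intro exI[of _ d]) auto
  next
    case (Suc d)
    then have "v (Suc d) < v d" using fast rest[of d] D(1) D(2)[of i] i by simp
    then show ?thesis using Suc i by (intro exI[of _ d]) auto
  qed
  then obtain d where "Suc d < Suc N" "v (Suc d) < v d" by blast
  then show ?case
  proof (rule forced.descent)
    fix d assume d: "Suc d < Suc N" "v (Suc d) < v d"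
    then show "forced (Suc N) m (reflect m d v) l"
      using cases[OF d] pass(1)[of d] sort(1)[of d] by argo
  next
    fix d' assume d: "Suc (Suc d') < Suc N" "v (Suc (Suc d')) < v (Suc d')"
    then show "reflect m (Suc d') v d' \<noteq> reflect m (Suc d') v (Suc d')"
      using cases[OF d] pass(2)[of "Suc d'" d'] sort(2)[of "Suc d'" d'] by argo
  next
    fix d assume d: "Suc (Suc d) < Suc N" "v (Suc d) < v d"
    then have d': "Suc d < Suc N" by simp
    show "reflect m d v (Suc d) \<noteq> reflect m d v (Suc (Suc d))"
      using cases[OF d' d(2)] pass(3)[of d] sort(3)[of d] d d' by argo
  qed
qed

lemma card_pairs_below:
  "card {(a, b). 0 < a \<and> a < b \<and> b \<le> N} = N choose 2"
proof (induction N)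
  case 0
  have "{(a, b). 0 < a \<and> a < b \<and> b \<le> (0::nat)} = {}" by auto
  then show ?case by (simp only: card.empty) (simp add: numeral_2_eq_2)
next
  case (Suc N)
  define A where "A = {(a, b). 0 < a \<and> a < b \<and> b \<le> N}"
  have split: "{(a, b). 0 < a \<and> a < b \<and> b \<le> Suc N} = A \<union> {1..N} \<times> {Suc N}"
    by (auto simp: A_def)
  have "finite A" by (rule finite_subset[of _ "{..N} \<times> {..N}"]) (auto simp: A_def)
  then have "card (A \<union> {1..N} \<times> {Suc N}) = card A + card ({1..N} \<times> {Suc N})"
    by (intro card_Un_disjoint) (auto simp: A_def)
  then have "card {(a, b). 0 < a \<and> a < b \<and> b \<le> Suc N} = (N choose 2) + N"
    unfolding split using Suc.IH by (simp add: A_def)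
  then show ?case by (simp add: numeral_2_eq_2)
qed

subsection \<open>Masses near the diagonal\<close>

text \<open>Triangular numbers have the increments 1, 2, 3, and so on, so the differences of
  consecutive values are the desired velocities \<eta>, 2\<eta>, 3\<eta>, and so on.\<close>

definition fast_vel :: "real \<Rightarrow> nat \<Rightarrow> real" where
  "fast_vel \<eta> i = 1 + \<eta> * (i * (i + 1) / 2)"

text \<open>Chosen such that a particle with index \<open>Suc i\<close> and velocity \<open>- fast_vel \<eta> (Suc i)\<close> that hits
  particle \<open>i\<close> at rest transfers the velocity \<open>- fast_vel \<eta> i\<close> and keeps \<open>\<eta> * Suc i\<close>.\<close>
fun mass :: "real \<Rightarrow> nat \<Rightarrow> real" where
  "mass \<eta> 0 = 1"
| "mass \<eta> (Suc i) = mass \<eta> i * fast_vel \<eta> i / (2 * fast_vel \<eta> (Suc i) - fast_vel \<eta> i)"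

lemma fast_vel_diff: "fast_vel \<eta> (Suc i) - fast_vel \<eta> i = \<eta> * Suc i"
  by (simp add: fast_vel_def field_simps)

lemma tendsto_fast_vel: "((\<lambda>\<eta>. fast_vel \<eta> i) \<longlongrightarrow> 1) (at 0)"
  unfolding fast_vel_def by (auto intro!: tendsto_eq_intros)

lemma tendsto_mass: "((\<lambda>\<eta>. mass \<eta> i) \<longlongrightarrow> 1) (at 0)"
proof (induction i)
  case (Suc i)
  have "((\<lambda>\<eta>. mass \<eta> i * fast_vel \<eta> i / (2 * fast_vel \<eta> (Suc i) - fast_vel \<eta> i)) \<longlongrightarrow>
      1 * 1 / (2 * 1 - 1)) (at 0)"
    by (intro tendsto_intros Suc tendsto_fast_vel) simp
  then show ?case by simp
qed simp

text \<open>By the first condition at most \<open>M^2\<close> swaps, each with an error of at most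
  \<open>8 * M^2 * \<eta>^2\<close>, accumulate less than the spacing \<open>|\<eta>|\<close> of the
  velocities. The others keep masses, speeds and the denominators of \<open>mass\<close>
  positive.\<close>

definition small :: "nat \<Rightarrow> real \<Rightarrow> bool" where
  "small M \<eta> \<longleftrightarrow> 8 * real M ^ 4 * \<bar>\<eta>\<bar> < 1 \<and>
    (\<forall>i<Suc M. 0 < mass \<eta> i \<and> 1 / 2 < fast_vel \<eta> i \<and>
      0 < 2 * fast_vel \<eta> (Suc i) - fast_vel \<eta> i)"

lemma eventually_small: "eventually (small M) (at 0)"
proof -
  have "((\<lambda>\<eta>. 8 * real M ^ 4 * \<bar>\<eta>\<bar>) \<longlongrightarrow> 8 * real M ^ 4 * \<bar>0\<bar>) (at 0)"
    by (intro tendsto_intros)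
  then have "eventually (\<lambda>\<eta>. 8 * real M ^ 4 * \<bar>\<eta>\<bar> < 1) (at 0)"
    by (rule order_tendstoD) simp
  moreover have "eventually (\<lambda>\<eta>. \<forall>i<Suc M. 0 < mass \<eta> i \<and> 1 / 2 < fast_vel \<eta> i \<and>
      0 < 2 * fast_vel \<eta> (Suc i) - fast_vel \<eta> i) (at 0)"
  proof (rule eventually_all_less)
    fix i
    have "((\<lambda>\<eta>. 2 * fast_vel \<eta> (Suc i) - fast_vel \<eta> i) \<longlongrightarrow> 2 * 1 - 1) (at 0)"
      by (intro tendsto_intros tendsto_fast_vel)
    then have "eventually (\<lambda>\<eta>. 0 < 2 * fast_vel \<eta> (Suc i) - fast_vel \<eta> i) (at 0)"
      by (rule order_tendstoD) simp
    moreover have "eventually (\<lambda>\<eta>. 0 < mass \<eta> i) (at 0)"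
      by (rule order_tendstoD(1)[OF tendsto_mass]) simp
    moreover have "eventually (\<lambda>\<eta>. 1 / 2 < fast_vel \<eta> i) (at 0)"
      by (rule order_tendstoD(1)[OF tendsto_fast_vel]) simp
    ultimately show "eventually (\<lambda>\<eta>. 0 < mass \<eta> i \<and> 1 / 2 < fast_vel \<eta> i \<and>
      0 < 2 * fast_vel \<eta> (Suc i) - fast_vel \<eta> i) (at 0)"
      by eventually_elim simp
  qed
  ultimately show ?thesis unfolding small_def by eventually_elim simp
qed

lemma mass_relation:
  assumes "small M \<eta>" "i < Suc M"
  shows "(mass \<eta> i + mass \<eta> (Suc i)) * fast_vel \<eta> i = 2 * mass \<eta> (Suc i) * fast_vel \<eta> (Suc i)"
proof -
  have "0 < 2 * fast_vel \<eta> (Suc i) - fast_vel \<eta> i" using assms by (simp add: small_def)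
  then have "mass \<eta> (Suc i) * (2 * fast_vel \<eta> (Suc i) - fast_vel \<eta> i) = mass \<eta> i * fast_vel \<eta> i"
    by simp
  then show ?thesis by (simp add: algebra_simps del: mass.simps)
qed

section \<open>Collision counts for the chosen masses and speeds\<close>

text \<open>The velocities left behind are \<open>\<eta> * j\<close>, so the sign of \<eta> decides
  whether no pair or every pair is inverted.\<close>

lemma small_forced:
  assumes small: "small M \<eta>" and N: "N \<le> M" and "\<eta> \<noteq> 0"
  shows "forced (Suc N) (mass \<eta>) (\<lambda>j. if j = N then - fast_vel \<eta> N else 0)
    (N + (if 0 < \<eta> then 0 else N choose 2))"
proof (cases "N = 0")
  case True
  then show ?thesis by (auto intro: forced.sorted simp: numeral_2_eq_2)
next
  case False
  define z :: "nat \<Rightarrow> real" where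
    "z j = (if j \<le> N then fast_vel \<eta> j - fast_vel \<eta> (j - 1) else 0)" for j
  have z: "z j = \<eta> * j" if "0 < j" "j \<le> N" for j
    using fast_vel_diff[of \<eta> "j - 1"] that by (simp add: z_def)
  define k where "k = card (inversions N z)"
  have "inversions N z = (if 0 < \<eta> then {} else {(a, b). 0 < a \<and> a < b \<and> b \<le> N})"
    using \<open>\<eta> \<noteq> 0\<close> by (auto simp: inversions_def z mult_less_cancel_left)
  then have k: "k = (if 0 < \<eta> then 0 else N choose 2)"
    using card_pairs_below[of N] by (simp add: k_def)
  have "inversions N z \<subseteq> {1..N} \<times> {1..N}" by (auto simp: inversions_def)
  then have "k \<le> card ({1..N} \<times> {1..N})" unfolding k_def by (intro card_mono) auto
  then have "k \<le> N * N" by simp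
  also have "\<dots> \<le> M * M" using N by (intro mult_le_mono) auto
  finally have kM: "real k \<le> real M * real M" by (metis of_nat_le_iff of_nat_mult)
  \<comment> \<open>Twice the bound \<open>M * |\<eta>|\<close> on the velocities left behind; the
    second half absorbs the reserve \<open>k * E < |\<eta>|\<close>.\<close>
  define D where "D = 2 * real M * \<bar>\<eta>\<bar>"
  \<comment> \<open>Mass differences relative to mass sums are at most
    \<open>2 * M * |\<eta>|\<close>, relative speeds at most
    \<open>2 * D = 4 * M * |\<eta>|\<close>; \<open>E\<close> is the product.\<close>
  define E where "E = 8 * real M ^ 2 * \<bar>\<eta>\<bar> * \<bar>\<eta>\<bar>"
  have \<eta>: "0 < \<bar>\<eta>\<bar>" and M: "1 \<le> real M" using \<open>\<eta> \<noteq> 0\<close> False N by auto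
  have "0 \<le> E" "0 \<le> D" by (simp_all add: E_def D_def)
  have "8 * real M ^ 4 * \<bar>\<eta>\<bar> < 1" using small by (simp add: small_def)
  then have "8 * real M ^ 4 * \<bar>\<eta>\<bar> * \<bar>\<eta>\<bar> < 1 * \<bar>\<eta>\<bar>" using \<eta> by (intro mult_strict_right_mono)
  moreover have "k * E \<le> real M * real M * E" using kM \<open>0 \<le> E\<close> by (intro mult_right_mono)
  moreover have "real M * real M * E = 8 * real M ^ 4 * \<bar>\<eta>\<bar> * \<bar>\<eta>\<bar>"
    by (simp add: E_def power2_eq_square power4_eq_xxxx algebra_simps)
  ultimately have kE: "k * E < \<bar>\<eta>\<bar>" by simp
  have "real M * 1 \<le> real M ^ 4" using M by (simp add: self_le_power)
  then have "8 * real M * \<bar>\<eta>\<bar> \<le> 8 * real M ^ 4 * \<bar>\<eta>\<bar>" by (intro mult_right_mono) auto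
  then have D: "D < 1 / 2" using \<open>8 * real M ^ 4 * \<bar>\<eta>\<bar> < 1\<close> by (simp add: D_def)
  have V: "1 / 2 < fast_vel \<eta> j" if "j \<le> N" for j using small that N by (simp add: small_def)
  have m: "0 < mass \<eta> j" if "j \<le> N" for j using small that N by (simp add: small_def)
  have "\<bar>mass \<eta> j - mass \<eta> (Suc j)\<bar> * (2 * D) \<le> E * (mass \<eta> j + mass \<eta> (Suc j))" if "j < N" for j
  proof -
    define S where "S = mass \<eta> j + mass \<eta> (Suc j)"
    have S: "0 < S" using m[of j] m[of "Suc j"] that by (simp add: S_def)
    \<comment> \<open>By \<open>mass_relation\<close> the left-hand side is \<open>S\<close> times
      the increment of \<open>fast_vel\<close>, so the mass difference is of order \<eta>.\<close>
    have "(mass \<eta> j - mass \<eta> (Suc j)) * fast_vel \<eta> (Suc j) = \<eta> * Suc j * S"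
      using mass_relation[OF small, of j] that N unfolding S_def fast_vel_diff[symmetric]
      by (simp add: algebra_simps del: mass.simps)
    then have "\<bar>mass \<eta> j - mass \<eta> (Suc j)\<bar> * \<bar>fast_vel \<eta> (Suc j)\<bar> = \<bar>\<eta>\<bar> * Suc j * S"
      using S by (simp add: abs_mult[symmetric]) (simp add: abs_mult)
    also have "\<dots> \<le> \<bar>\<eta>\<bar> * M * S"
      using that N S by (intro mult_right_mono mult_left_mono) auto
    finally have "\<bar>mass \<eta> j - mass \<eta> (Suc j)\<bar> * \<bar>fast_vel \<eta> (Suc j)\<bar> \<le> \<bar>\<eta>\<bar> * M * S" .
    moreover have "\<bar>mass \<eta> j - mass \<eta> (Suc j)\<bar> * (1 / 2) \<le>
        \<bar>mass \<eta> j - mass \<eta> (Suc j)\<bar> * \<bar>fast_vel \<eta> (Suc j)\<bar>"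
      using V[of "Suc j"] that by (intro mult_left_mono) auto
    ultimately have "\<bar>mass \<eta> j - mass \<eta> (Suc j)\<bar> \<le> 2 * (\<bar>\<eta>\<bar> * M * S)" by simp
    then have "\<bar>mass \<eta> j - mass \<eta> (Suc j)\<bar> * (2 * D) \<le> 2 * (\<bar>\<eta>\<bar> * M * S) * (2 * D)"
      using \<open>0 \<le> D\<close> by (intro mult_right_mono) auto
    also have "\<dots> = E * S" by (simp add: D_def E_def power2_eq_square)
    finally show ?thesis by (simp add: S_def)
  qed
  moreover have "dispersed N D E z k"
    unfolding dispersed_def
  proof (intro conjI allI impI)
    fix j assume j: "0 < j \<and> j \<le> N"
    have "\<bar>z j\<bar> = \<bar>\<eta>\<bar> * j" using j by (simp add: z abs_mult)
    also have "\<dots> \<le> \<bar>\<eta>\<bar> * M" using j N by (intro mult_left_mono) auto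
    finally have "\<bar>z j\<bar> \<le> \<bar>\<eta>\<bar> * M" .
    moreover have "\<bar>\<eta>\<bar> * 1 \<le> \<bar>\<eta>\<bar> * M" using M by (intro mult_left_mono) auto
    ultimately show "\<bar>z j\<bar> + k * E \<le> D" using kE by (simp add: D_def algebra_simps)
  next
    fix a b assume ab: "0 < a \<and> a \<le> N \<and> 0 < b \<and> b \<le> N \<and> a \<noteq> b"
    have "1 \<le> \<bar>real a - real b\<bar>" using ab by (cases "a < b") auto
    then have "\<bar>\<eta>\<bar> * 1 \<le> \<bar>\<eta>\<bar> * \<bar>real a - real b\<bar>" by (intro mult_left_mono) auto
    also have "\<dots> = \<bar>z a - z b\<bar>"
      using ab by (simp add: z abs_mult[symmetric] right_diff_distrib)
    finally show "k * E < \<bar>z a - z b\<bar>" using kE by simp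
  qed
  ultimately show ?thesis
    unfolding k[symmetric]
    by (intro forced_pass[where V = "fast_vel \<eta>" and i = N and z = z and k = k and D = D and E = E])
      (use m V D mass_relation[OF small] N \<open>0 \<le> D\<close> \<open>0 \<le> E\<close> in \<open>force simp: z_def k_def\<close>)+
qed

text \<open>A cluster with velocities \<open>s * w\<close> is at rest in the limit of small
  \<open>s\<close>. There \<open>eventually_forced\<close> applies, since increasing
  \<open>w\<close> makes every tie a pair that does not approach. Dividing by \<open>s\<close>
  restores \<open>w\<close> and turns the speed \<open>c\<close> into \<open>c / s\<close>.\<close>

lemma exists_fast_speed:
  assumes forced: "forced (Suc N) m (\<lambda>j. if j = N then - c else 0) k" and "0 < c"
    and m: "\<And>j. j \<le> N \<Longrightarrow> 0 < m j" and w: "increasing N w"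
  obtains V where "0 < V" "forced (Suc N) m (w(N := - V)) k" "untied (Suc N) (w(N := - V))"
proof -
  define f where "f s = (\<lambda>j. if j = N then - c else s * w j)" for s :: real
  have pos: "eventually (\<lambda>s::real. 0 < s) (at_right 0)" by (simp add: eventually_at_filter)
  have lim: "((\<lambda>s. f s j) \<longlongrightarrow> (if j = N then - c else 0)) (at_right 0)" for j
    unfolding f_def by (auto intro!: tendsto_eq_intros)
  have less: "eventually (\<lambda>s. f s j < f s (Suc j)) (at_right 0)" if "Suc j < N" for j
    using pos by eventually_elim (use that w in \<open>auto simp: f_def increasing_def\<close>)
  have "eventually (\<lambda>s. forced (Suc N) m (f s) k) (at_right 0)"
    by (rule eventually_forced[OF forced]) (use m lim less \<open>0 < c\<close> in \<open>auto split: if_splits\<close>)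
  moreover have "eventually (\<lambda>s. \<forall>j. Suc j < Suc N \<longrightarrow> f s j \<noteq> f s (Suc j)) (at_right 0)"
  proof (rule eventually_all_Suc_less)
    fix j assume j: "Suc j < Suc N"
    show "eventually (\<lambda>s. f s j \<noteq> f s (Suc j)) (at_right 0)"
    proof (cases "Suc j = N")
      case True
      have "eventually (\<lambda>s. f s (Suc j) < f s j) (at_right 0)"
        by (rule tendsto_eventually_less[OF lim lim]) (use True \<open>0 < c\<close> in auto)
      then show ?thesis by eventually_elim simp
    next
      case False
      then show ?thesis using less[of j] j by (auto elim: eventually_mono)
    qed
  qed
  ultimately have "eventually (\<lambda>s. 0 < s \<and> forced (Suc N) m (f s) k \<and> untied (Suc N) (f s)) (at_right 0)"
    using pos unfolding untied_def by eventually_elim simp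
  then obtain s where s: "0 < s" "forced (Suc N) m (f s) k" "untied (Suc N) (f s)"
    by (metis (mono_tags, lifting) eventually_happens trivial_limit_at_right_real)
  have eq: "w(N := - (c / s)) = (\<lambda>j. 1 / s * f s j)" using s(1) by (auto simp: f_def)
  show thesis
  proof (rule that)
    show "0 < c / s" using s \<open>0 < c\<close> by simp
    show "forced (Suc N) m (w(N := - (c / s))) k"
      unfolding eq using s by (intro forced_scale) auto
    show "untied (Suc N) (w(N := - (c / s)))"
      unfolding eq using s by (auto simp: untied_def)
  qed
qed

lemma small_fast_speed:
  assumes "small M \<eta>" "N \<le> M" "\<eta> \<noteq> 0" "increasing N w"
  obtains V where "0 < V" "untied (Suc N) (w(N := - V))"
    "forced (Suc N) (mass \<eta>) (w(N := - V)) (N + (if 0 < \<eta> then 0 else N choose 2))"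
proof (rule exists_fast_speed[OF small_forced[OF assms(1-3)] _ _ assms(4)])
  have "1 / 2 < fast_vel \<eta> N" using assms(1,2) by (simp add: small_def)
  then show "0 < fast_vel \<eta> N" by linarith
  show "0 < mass \<eta> j" if "j \<le> N" for j using assms(1,2) that by (simp add: small_def)
qed (use that in blast)

lemma closure_robust_nonempty: "q \<in> closure {x. robust n m x v k} \<Longrightarrow> \<exists>x. robust n m x v k"
  by (metis (mono_tags, lifting) closure_empty empty_iff empty_Collect_eq)

lemma small_robust:
  assumes "small M \<eta>" "N \<le> M" "\<eta> \<noteq> 0"
  shows "\<exists>q v. robust (Suc N) (mass \<eta>) q v (N + (if 0 < \<eta> then 0 else N choose 2))"
proof -
  \<comment> \<open>The embedding \<open>real\<close> serves both as starting positions and as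
    velocities of the cluster.\<close>
  have inc: "increasing n real" for n by (simp add: increasing_def)
  obtain V where "untied (Suc N) (real(N := - V))"
    "forced (Suc N) (mass \<eta>) (real(N := - V)) (N + (if 0 < \<eta> then 0 else N choose 2))"
    using small_fast_speed[OF assms inc] .
  then have "real \<in> closure {x. robust (Suc N) (mass \<eta>) x (real(N := - V))
      (N + (if 0 < \<eta> then 0 else N choose 2))}"
    using assms(1,2) inc by (intro forced_closure_robust) (auto simp: small_def)
  then show ?thesis using closure_robust_nonempty by blast
qed

text \<open>Induction over the arrivals: \<open>robust_append_fast\<close> lets the old cluster
  finish its collisions, and \<open>small_fast_speed\<close> adapts the speed of the new particle to
  the velocities \<open>v'\<close> that the cluster then has.\<close>

lemma small_robust_cubic:
  assumes small: "small M \<eta>" and "\<eta> < 0"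
  shows "N \<le> Suc M \<Longrightarrow> \<exists>q v. robust N (mass \<eta>) q v ((N + 1) choose 3)"
proof (induction N)
  case 0
  have "increasing 0 (\<lambda>_. 0)" by (simp add: increasing_def)
  from robust.free[OF this this] show ?case by (auto simp: numeral_3_eq_3)
next
  case (Suc N)
  then obtain q v where robust: "robust N (mass \<eta>) q v ((N + 1) choose 3)" by auto
  have m: "0 < mass \<eta> j" if "j < Suc N" for j using small Suc.prems that by (simp add: small_def)
  obtain T B q' v' where T: "0 \<le> T" and inc: "increasing N q'" "increasing N v'"
    and B: "\<And>j. j < N \<Longrightarrow> q' j \<le> B"
    and append: "\<And>P V l. B < P \<Longrightarrow> 0 < V \<Longrightarrow>
      q'(N := P) \<in> closure {x. robust (Suc N) (mass \<eta>) x (v'(N := - V)) l} \<Longrightarrow>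
      q(N := P + V * T) \<in> closure {x. robust (Suc N) (mass \<eta>) x (v(N := - V)) (((N + 1) choose 3) + l)}"
    using robust_append_fast[OF robust] m by (metis less_SucI)
  obtain V where V: "0 < V" "untied (Suc N) (v'(N := - V))"
    "forced (Suc N) (mass \<eta>) (v'(N := - V)) (N + (N choose 2))"
    using small_fast_speed[OF small _ _ inc(2)] Suc.prems \<open>\<eta> < 0\<close> by auto
  have "increasing (Suc N) (q'(N := B + 1))"
    using inc(1) by (rule increasing_upd) (use B in force)
  then have "q'(N := B + 1) \<in> closure {x. robust (Suc N) (mass \<eta>) x (v'(N := - V)) (N + (N choose 2))}"
    using V m by (intro forced_closure_robust) auto
  from closure_robust_nonempty[OF append[OF _ V(1) this]]
  have "\<exists>x. robust (Suc N) (mass \<eta>) x (v(N := - V)) (((N + 1) choose 3) + (N + (N choose 2)))"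
    by simp
  \<comment> \<open>Pascal's rule, applied to both \<open>(N + 2) choose 3\<close> and
    \<open>(N + 1) choose 2\<close>.\<close>
  moreover have "((N + 1) choose 3) + (N + (N choose 2)) = (Suc N + 1) choose 3"
    by (simp add: numeral_3_eq_3 numeral_2_eq_2)
  ultimately show ?case by metis
qed

subsection \<open>Open sets of masses and initial data\<close>

text \<open>Robustness is an open condition on masses, positions and velocities jointly, and a
  neighbourhood contains a product of open sets: one factor gives \<open>W\<close>, the other
  \<open>U\<close>.\<close>

lemma robust_open_boxes:
  assumes robust: "robust n m q v k"
    and m: "\<And>j. j < n \<Longrightarrow> 0 < m j" "\<And>j. j < n \<Longrightarrow> \<bar>m j - 1\<bar> < \<epsilon>"
  shows "\<exists>W U. W \<noteq> {} \<and> openin (top_of_set (Rn n)) W \<and> W \<subseteq> mass_box n \<epsilon> \<and>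
    U \<noteq> {} \<and> openin (top_of_set (Rn n \<times> Rn n)) U \<and> U \<subseteq> ordered_data n \<and>
    (\<forall>m\<in>W. \<forall>(q, v)\<in>U. evolves n m q v k)"
proof -
  \<comment> \<open>Truncation moves the data into \<open>Rn n\<close>; by
    \<open>robust_cong\<close> robustness is not affected.\<close>
  define cut :: "(nat \<Rightarrow> real) \<Rightarrow> nat \<Rightarrow> real" where "cut x = (\<lambda>j. if j < n then x j else 0)" for x
  have cut: "cut x \<in> Rn n" for x by (simp add: cut_def Rn_def)
  let ?F = "nhds (cut m, cut q, cut v)"
  have "(fst \<longlongrightarrow> cut m) ?F" "((\<lambda>x. fst (snd x)) \<longlongrightarrow> cut q) ?F"
    "((\<lambda>x. snd (snd x)) \<longlongrightarrow> cut v) ?F"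
    using tendsto_fst[OF filterlim_ident, of "(cut m, cut q, cut v)"]
      tendsto_fst[OF tendsto_snd[OF filterlim_ident], of "(cut m, cut q, cut v)"]
      tendsto_snd[OF tendsto_snd[OF filterlim_ident], of "(cut m, cut q, cut v)"]
    by simp_all
  note lim = filterlim_compose[OF tendsto_coordinate this(1)]
    filterlim_compose[OF tendsto_coordinate this(2)] filterlim_compose[OF tendsto_coordinate this(3)]
  have "robust n (cut m) (cut q) (cut v) k"
    by (rule robust_cong[OF robust m(1)]) (auto simp: cut_def)
  then have "eventually (\<lambda>x. robust n (fst x) (fst (snd x)) (snd (snd x)) k) ?F"
  proof (rule eventually_robust)
    show "0 < cut m j" if "j < n" for j using m that by (simp add: cut_def)
  qed (rule lim)+
  moreover have "eventually (\<lambda>x. \<forall>j<n. 0 < fst x j \<and> \<bar>fst x j - 1\<bar> < \<epsilon>) ?F"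
  proof (rule eventually_all_less)
    fix j assume j: "j < n"
    have "eventually (\<lambda>x. 0 < fst x j) ?F"
      by (rule order_tendstoD(1)[OF lim(1)]) (use m j in \<open>auto simp: cut_def\<close>)
    moreover have "((\<lambda>x. \<bar>fst x j - 1\<bar>) \<longlongrightarrow> \<bar>cut m j - 1\<bar>) ?F" by (intro tendsto_intros lim)
    then have "eventually (\<lambda>x. \<bar>fst x j - 1\<bar> < \<epsilon>) ?F"
      by (rule order_tendstoD(2)) (use m j in \<open>auto simp: cut_def\<close>)
    ultimately show "eventually (\<lambda>x. 0 < fst x j \<and> \<bar>fst x j - 1\<bar> < \<epsilon>) ?F"
      by eventually_elim simp
  qed
  ultimately have "eventually (\<lambda>x. robust n (fst x) (fst (snd x)) (snd (snd x)) k \<and>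
      (\<forall>j<n. 0 < fst x j \<and> \<bar>fst x j - 1\<bar> < \<epsilon>)) ?F"
    by eventually_elim simp
  then obtain S where S: "open S" "(cut m, cut q, cut v) \<in> S"
    and good: "\<And>x. x \<in> S \<Longrightarrow> robust n (fst x) (fst (snd x)) (snd (snd x)) k"
      "\<And>x j. x \<in> S \<Longrightarrow> j < n \<Longrightarrow> 0 < fst x j \<and> \<bar>fst x j - 1\<bar> < \<epsilon>"
    unfolding eventually_nhds by blast
  obtain A B where AB: "open A" "open B" "(cut m, cut q, cut v) \<in> A \<times> B" "A \<times> B \<subseteq> S"
    using S open_prod_def by (metis open_prod_elim)
  define W U where "W = Rn n \<inter> A" and "U = (Rn n \<times> Rn n) \<inter> B"
  have mem: "cut m \<in> W" "(cut q, cut v) \<in> U" using AB(3) cut by (auto simp: W_def U_def)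
  have in_S: "(m', q', v') \<in> S" if "m' \<in> W" "(q', v') \<in> U" for m' q' v'
    using that AB(4) by (auto simp: W_def U_def)
  have masses: "0 < m' j \<and> \<bar>m' j - 1\<bar> < \<epsilon>" if "m' \<in> W" "j < n" for m' j
    using good(2)[OF in_S[OF that(1) mem(2)] that(2)] by simp
  have "W \<subseteq> mass_box n \<epsilon>"
    using masses by (force simp: mass_box_def W_def abs_less_iff)
  moreover have "U \<subseteq> ordered_data n"
    using good(1)[OF in_S[OF mem(1)], THEN robust_increasing]
    by (auto simp: U_def ordered_data_def increasing_def)
  moreover have "evolves n m' q' v' k" if "m' \<in> W" "(q', v') \<in> U" for m' q' v'
    using robust_imp_evolves[of n m' q' v' k] good(1)[OF in_S[OF that]] masses[OF that(1)] by simp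
  moreover have "openin (top_of_set (Rn n)) W" "openin (top_of_set (Rn n \<times> Rn n)) U"
    using AB(1,2) by (auto simp: W_def U_def openin_open)
  ultimately show ?thesis using mem
    by (intro exI[of _ W] exI[of _ U]) auto
qed

theorem theorem1:
  fixes n :: nat and \<epsilon> :: real
  assumes "\<epsilon> > 0"
  shows "\<exists>W1 W2 W3 U1 U2 U3.
    (\<forall>W\<in>{W1, W2, W3}. W \<noteq> {} \<and> openin (top_of_set (Rn n)) W \<and> W \<subseteq> mass_box n \<epsilon>) \<and>
    (\<forall>U\<in>{U1, U2, U3}. U \<noteq> {} \<and> openin (top_of_set (Rn n \<times> Rn n)) U \<and> U \<subseteq> ordered_data n) \<and>
    (\<forall>m\<in>W1. \<forall>(q, v)\<in>U1. evolves n m q v (n - 1)) \<and>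
    (\<forall>m\<in>W2. \<forall>(q, v)\<in>U2. evolves n m q v (n choose 2)) \<and>
    (\<forall>m\<in>W3. \<forall>(q, v)\<in>U3. evolves n m q v ((n + 1) choose 3))"
proof -
  have "eventually (\<lambda>\<eta>. \<forall>j<n. \<bar>mass \<eta> j - 1\<bar> < \<epsilon>) (at 0)"
  proof (rule eventually_all_less)
    fix j
    have "((\<lambda>\<eta>. \<bar>mass \<eta> j - 1\<bar>) \<longlongrightarrow> \<bar>1 - 1\<bar>) (at 0)" by (intro tendsto_intros tendsto_mass)
    then show "eventually (\<lambda>\<eta>. \<bar>mass \<eta> j - 1\<bar> < \<epsilon>) (at 0)"
      by (rule order_tendstoD) (use assms in simp)
  qed
  with eventually_small[of n]
  have ev: "eventually (\<lambda>\<eta>. small n \<eta> \<and> (\<forall>j<n. \<bar>mass \<eta> j - 1\<bar> < \<epsilon>)) (at 0)"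
    by eventually_elim simp
  then have "eventually (\<lambda>\<eta>. small n \<eta> \<and> (\<forall>j<n. \<bar>mass \<eta> j - 1\<bar> < \<epsilon>)) (at_right 0)"
    "eventually (\<lambda>\<eta>. small n \<eta> \<and> (\<forall>j<n. \<bar>mass \<eta> j - 1\<bar> < \<epsilon>)) (at_left 0)"
    by (simp_all add: eventually_at_split)
  moreover have "eventually (\<lambda>\<eta>::real. 0 < \<eta>) (at_right 0)" "eventually (\<lambda>\<eta>::real. \<eta> < 0) (at_left 0)"
    by (simp_all add: eventually_at_filter)
  ultimately have "eventually (\<lambda>\<eta>. 0 < \<eta> \<and> small n \<eta> \<and> (\<forall>j<n. \<bar>mass \<eta> j - 1\<bar> < \<epsilon>)) (at_right 0)"
    "eventually (\<lambda>\<eta>. \<eta> < 0 \<and> small n \<eta> \<and> (\<forall>j<n. \<bar>mass \<eta> j - 1\<bar> < \<epsilon>)) (at_left 0)"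
    by (auto intro: eventually_conj)
  \<comment> \<open>Masses from \<open>\<alpha>\<close> leave a sorted cluster and give the linear
    count; masses from \<open>\<beta>\<close> leave a reversed one and give the other two.\<close>
  then obtain \<alpha> \<beta> where \<alpha>: "0 < \<alpha>" "small n \<alpha>" "\<And>j. j < n \<Longrightarrow> \<bar>mass \<alpha> j - 1\<bar> < \<epsilon>"
    and \<beta>: "\<beta> < 0" "small n \<beta>" "\<And>j. j < n \<Longrightarrow> \<bar>mass \<beta> j - 1\<bar> < \<epsilon>"
    by (metis (mono_tags, lifting) eventually_happens trivial_limit_at_left_real trivial_limit_at_right_real)
  have pos: "0 < mass \<alpha> j" "0 < mass \<beta> j" if "j < n" for j
    using \<alpha>(2) \<beta>(2) that by (auto simp: small_def)
  \<comment> \<open>The empty system is treated separately, since \<open>small_robust\<close> always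
    produces at least one particle. For \<open>n = 0\<close> the count \<open>n - 1\<close> is 0 by
    truncated subtraction.\<close>
  have free: "\<exists>q v. robust 0 m q v 0" for m
    using robust.free[of 0 "\<lambda>_. 0" "\<lambda>_. 0"] by (auto simp: increasing_def)
  have "\<exists>q v. robust n (mass \<alpha>) q v (n - 1)"
    using small_robust[OF \<alpha>(2), of "n - 1"] \<alpha>(1) free by (cases n) auto
  then obtain q1 v1 where "robust n (mass \<alpha>) q1 v1 (n - 1)" by blast
  from robust_open_boxes[OF this pos(1) \<alpha>(3)] obtain W1 U1 where 1:
    "W1 \<noteq> {}" "openin (top_of_set (Rn n)) W1" "W1 \<subseteq> mass_box n \<epsilon>"
    "U1 \<noteq> {}" "openin (top_of_set (Rn n \<times> Rn n)) U1" "U1 \<subseteq> ordered_data n"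
    "\<forall>m\<in>W1. \<forall>(q, v)\<in>U1. evolves n m q v (n - 1)"
    by blast
  have "\<exists>q v. robust n (mass \<beta>) q v (n choose 2)"
  proof (cases n)
    case (Suc N)
    then have "n choose 2 = N + (N choose 2)" by (simp add: numeral_2_eq_2)
    then show ?thesis using small_robust[OF \<beta>(2), of N] \<beta>(1) Suc by auto
  qed (use free in \<open>simp add: numeral_2_eq_2\<close>)
  then obtain q2 v2 where "robust n (mass \<beta>) q2 v2 (n choose 2)" by blast
  from robust_open_boxes[OF this pos(2) \<beta>(3)] obtain W2 U2 where 2:
    "W2 \<noteq> {}" "openin (top_of_set (Rn n)) W2" "W2 \<subseteq> mass_box n \<epsilon>"
    "U2 \<noteq> {}" "openin (top_of_set (Rn n \<times> Rn n)) U2" "U2 \<subseteq> ordered_data n"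
    "\<forall>m\<in>W2. \<forall>(q, v)\<in>U2. evolves n m q v (n choose 2)"
    by blast
  obtain q3 v3 where "robust n (mass \<beta>) q3 v3 ((n + 1) choose 3)"
    using small_robust_cubic[OF \<beta>(2,1), of n] by auto
  from robust_open_boxes[OF this pos(2) \<beta>(3)] obtain W3 U3 where 3:
    "W3 \<noteq> {}" "openin (top_of_set (Rn n)) W3" "W3 \<subseteq> mass_box n \<epsilon>"
    "U3 \<noteq> {}" "openin (top_of_set (Rn n \<times> Rn n)) U3" "U3 \<subseteq> ordered_data n"
    "\<forall>m\<in>W3. \<forall>(q, v)\<in>U3. evolves n m q v ((n + 1) choose 3)"
    by blast
  show ?thesis
    by (rule exI[of _ W1], rule exI[of _ W2], rule exI[of _ W3],
        rule exI[of _ U1], rule exI[of _ U2], rule exI[of _ U3])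
      (use 1 2 3 in simp)
qed

end
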